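(* Let $M,K,H,I,J,N$ be positive integers and let $\mathbb{X}\subseteq\mathbb{R}^K$ be closed. Suppose the uncertain parameters separate as $\bm{\xi}=(\bm{\xi}_1,\dots,\bm{\xi}_N)$ with $\bm{\xi}_n\in\Xi_n$, where for each $n\in[N]$ the set $\Xi_n=\{\bm{\xi}_n\in\mathbb{R}^M:\bm{C}_n\bm{\xi}_n\le\bm{g}_n\}$ is a nonempty polytope ($\bm{C}_n$ a matrix and $\bm{g}_n$ a vector of appropriate dimension), and let $\Xi=\Xi_1\times\cdots\times\Xi_N$. Suppose the objective function is additively separable, $$\ell(\bm{x},\bm{\xi})=\sum_{n=1}^{N}\max_{j\in[J]}\ell_{nj}(\bm{x},\bm{\xi}_n),$$ where for every fixed $\bm{x}\in\mathbb{X}$, $\ell_{nj}(\bm{x},\bm{\xi}_n)=\langle\bm{a}_{nj},\bm{\xi}_n\rangle+b_{nj}$ with $\bm{a}_{nj}=\bm{a}_{nj}(\bm{x})\in\mathbb{R}^M$ and $b_{nj}=b_{nj}(\bm{x})\in\mathbb{R}$ linear in $\bm{x}$, for all $n\in[N]$, $j\in[J]$. Let $\hat{\bm{\xi}}^{(i)}_h=(\hat{\bm{\xi}}^{(i)}_{h,1},\dots,\hat{\bm{\xi}}^{(i)}_{h,N})\in\Xi$ ($h\in[H]$, $i\in[I]$) be given points, let $t^{(I)}_h\in[0,1]$ ($h\in[H]$) be weights with $\sum_{h=1}^H t^{(I)}_h=1$, and let $\hat{\mathbb{P}}_{HI}:=\sum_{h=1}^{H}\frac{t^{(I)}_h}{I}\sum_{i=1}^{I}\delta_{\hat{\bm{\xi}}^{(i)}_h}$.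 Let the ambiguity set $\mathbb{B}_\epsilon(\hat{\mathbb{P}}_{HI})$ be defined with the norm $\|\bm{\xi}\|_N=\sum_{n=1}^N\|\bm{\xi}_n\|$ in the Wasserstein distance, where $\|\cdot\|$ is a fixed norm on $\mathbb{R}^M$. Then for any $\epsilon\ge0$, the problem $$\inf_{\bm{x}\in\mathbb{X}}\ \sup_{\mathbb{Q}\in\mathbb{B}_\epsilon(\hat{\mathbb{P}}_{HI})}\mathbb{E}^{\mathbb{Q}}[\ell(\bm{x},\bm{\xi})]$$ can be reformulated as $$\begin{aligned} \inf_{\bm{x},\,\lambda,\,s_{hin},\,\bm{\gamma}_{hijn}}\quad & \lambda\epsilon+\sum_{h=1}^{H}\sum_{i=1}^{I}\sum_{n=1}^{N}\frac{t^{(I)}_h}{I}\,s_{hin}\\ \text{s.t.}\quad & \bm{x}\in\mathbb{X},\\ & b_{nj}+\langle\bm{a}_{nj},\hat{\bm{\xi}}^{(i)}_{h,n}\rangle+\langle\bm{\gamma}_{hijn},\bm{g}_n-\bm{C}_n\hat{\bm{\xi}}^{(i)}_{h,n}\rangle\le s_{hin},\\ & \|\bm{C}_n^{\mathsf T}\bm{\gamma}_{hijn}-\bm{a}_{nj}\|_*\le\lambda,\\ & \bm{\gamma}_{hijn}\ge0, \end{aligned}$$ where the last three constraints hold for all $h\in[H]$, $i\in[I]$, $j\in[J]$, $n\in[N]$; that is, for each fixed $\bm{x}\in\mathbb{X}$ the inner supremum equals the infimum of the second program over the remaining variables $(\lambda,s_{hin},\bm{\gamma}_{hijn})$, and in particular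 the two problems have the same optimal value.
   Context: Notation: $[N]=\{1,\dots,N\}$; $\langle\bm{u},\bm{v}\rangle=\bm{u}^{\mathsf T}\bm{v}$; $\delta_{\bm{\xi}_0}$ is the Dirac point mass at $\bm{\xi}_0$; vector inequalities are componentwise. For the norm $\|\cdot\|$ on $\mathbb{R}^M$, the dual norm is $\|\bm{v}\|_*:=\sup_{\|\bm{u}\|\le1}\langle\bm{v},\bm{u}\rangle$. $\mathcal{M}(\Xi)$ is the set of all probability distributions $\mathbb{Q}$ on $\Xi$ with $\mathbb{E}^{\mathbb{Q}}[\|\bm{\xi}\|_N]<\infty$. The Wasserstein distance is $d_W(\hat{\mathbb{P}},\mathbb{Q})=\inf_{\Pi}\int_{\Xi^2}\|\bm{\xi}-\bm{\xi}'\|_N\,\Pi(d\bm{\xi},d\bm{\xi}')$, the infimum being over joint distributions $\Pi$ of $\bm{\xi}$ and $\bm{\xi}'$ with marginals $\mathbb{Q}$ and $\hat{\mathbb{P}}$ respectively. The ambiguity set is $\mathbb{B}_\epsilon(\hat{\mathbb{P}}_{HI})=\{\mathbb{Q}\in\mathcal{M}(\Xi): d_W(\hat{\mathbb{P}}_{HI},\mathbb{Q})\le\epsilon\}$. *)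

theory Defs
  imports "HOL-Probability.Probability"
begin

text \<open>
  The index sets for the components, the clusters, the samples and the affine pieces are finite
  types \<open>'n\<close>, \<open>'h\<close>, \<open>'i\<close>, \<open>'j\<close>, and \<open>\<xi> :: real^'m^'n\<close> has the blocks \<open>\<xi> $ n :: real^'m\<close>.
  The number of rows of \<open>C\<^sub>n\<close> may depend on \<open>n\<close>, so a matrix with \<open>L\<close> rows is given by its rows
  \<open>C 0, \<dots>, C (L - 1)\<close>; vectors of length \<open>L\<close> are functions on \<open>nat\<close> of which only the values
  below \<open>L\<close> are ever used.
\<close>

definition polyhedral_set :: "nat \<Rightarrow> (nat \<Rightarrow> real^'m) \<Rightarrow> (nat \<Rightarrow> real) \<Rightarrow> (real^'m) set" where
  "polyhedral_set L C g = {\<xi>. \<forall>l<L. C l \<bullet> \<xi> \<le> g l}"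

definition block_product :: "('n \<Rightarrow> (real^'m) set) \<Rightarrow> (real^'m^'n) set" where
  "block_product S = {\<xi>. \<forall>n. \<xi> $ n \<in> S n}"

subsection \<open>Norms\<close>

text \<open>The norm on \<open>real^'m\<close> is arbitrary, so it is a parameter rather than the type class norm.\<close>

definition is_norm :: "('a::real_vector \<Rightarrow> real) \<Rightarrow> bool" where
  "is_norm \<nu> \<longleftrightarrow>
     (\<forall>u. 0 \<le> \<nu> u) \<and> (\<forall>u. \<nu> u = 0 \<longleftrightarrow> u = 0) \<and>
     (\<forall>c u. \<nu> (c *\<^sub>R u) = \<bar>c\<bar> * \<nu> u) \<and> (\<forall>u v. \<nu> (u + v) \<le> \<nu> u + \<nu> v)"

text \<open>
  The supremum is a genuine one for a norm \<open>\<nu>\<close>: the set contains \<open>0\<close>, and it is bounded because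
  all norms on a finite-dimensional space are equivalent.
\<close>

definition dual_norm :: "('a::real_inner \<Rightarrow> real) \<Rightarrow> 'a \<Rightarrow> real" where
  "dual_norm \<nu> v = (SUP u\<in>{u. \<nu> u \<le> 1}. v \<bullet> u)"

definition norm_sum :: "(real^'m \<Rightarrow> real) \<Rightarrow> real^'m^'n \<Rightarrow> real" where
  "norm_sum \<nu> \<xi> = (\<Sum>n\<in>UNIV. \<nu> (\<xi> $ n))"

subsection \<open>Distributions and the Wasserstein ball\<close>

abbreviation borel_on :: "'a::topological_space set \<Rightarrow> 'a measure" where
  "borel_on S \<equiv> restrict_space borel S"

text \<open>\<open>space (prob_algebra M)\<close> is the set of all probability measures on the measurable space \<open>M\<close>.\<close>

definition finite_moment_distributions ::
  "('a::topological_space \<Rightarrow> real) \<Rightarrow> 'a set \<Rightarrow> 'a measure set" where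
  "finite_moment_distributions \<nu> S =
     {Q \<in> space (prob_algebra (borel_on S)). (\<integral>\<^sup>+\<xi>. ennreal (\<nu> \<xi>) \<partial>Q) < \<infinity>}"

definition couplings ::
  "'a::topological_space set \<Rightarrow> 'a measure \<Rightarrow> 'a measure \<Rightarrow> ('a \<times> 'a) measure set" where
  "couplings S Q P =
     {\<kappa> \<in> space (prob_algebra (borel_on S \<Otimes>\<^sub>M borel_on S)).
        distr \<kappa> (borel_on S) fst = Q \<and> distr \<kappa> (borel_on S) snd = P}"

definition wasserstein ::
  "('a::{topological_space,minus} \<Rightarrow> real) \<Rightarrow> 'a set \<Rightarrow> 'a measure \<Rightarrow> 'a measure \<Rightarrow> ennreal" where
  "wasserstein \<nu> S P Q =
     (INF \<kappa>\<in>couplings S Q P. \<integral>\<^sup>+(\<xi>, \<xi>'). ennreal (\<nu> (\<xi> - \<xi>')) \<partial>\<kappa>)"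

definition ambiguity_set ::
  "('a::{topological_space,minus} \<Rightarrow> real) \<Rightarrow> 'a set \<Rightarrow> real \<Rightarrow> 'a measure \<Rightarrow> 'a measure set" where
  "ambiguity_set \<nu> S \<epsilon> P =
     {Q \<in> finite_moment_distributions \<nu> S. wasserstein \<nu> S P Q \<le> ennreal \<epsilon>}"

text \<open>The mixture of the Dirac measures at \<open>\<zeta> h i\<close> with weights \<open>t h / I\<close>, as a measure on \<open>S\<close>.\<close>

definition weighted_empirical ::
  "'a::topological_space set \<Rightarrow> ('h::finite \<Rightarrow> real) \<Rightarrow> ('h \<Rightarrow> 'i::finite \<Rightarrow> 'a) \<Rightarrow> 'a measure" where
  "weighted_empirical S t \<zeta> =
     measure_of S (sets (borel_on S))
       (\<lambda>A. \<Sum>h\<in>UNIV. \<Sum>i\<in>UNIV.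
          ennreal (t h / real CARD('i)) * emeasure (return (borel_on S) (\<zeta> h i)) A)"

lemma space_weighted_empirical [simp]: "space (weighted_empirical S t \<zeta>) = S"
  by (simp add: weighted_empirical_def space_measure_of_conv)

lemma sets_weighted_empirical [simp]: "sets (weighted_empirical S t \<zeta>) = sets (borel_on S)"
proof -
  have "sigma_sets S (sets (borel_on S)) = sets (borel_on S)"
    using sets.sigma_sets_eq[of "borel_on S"] by (simp add: space_restrict_space)
  moreover have "sets (borel_on S) \<subseteq> Pow S"
    using sets.space_closed[of "borel_on S"] by (simp add: space_restrict_space)
  ultimately show ?thesis
    by (simp add: weighted_empirical_def)
qed

lemma emeasure_weighted_empirical:
  fixes \<zeta> :: "'h::finite \<Rightarrow> 'i::finite \<Rightarrow> 'a::topological_space"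
  assumes A: "A \<in> sets (borel_on S)"
  shows "emeasure (weighted_empirical S t \<zeta>) A =
    (\<Sum>h\<in>UNIV. \<Sum>i\<in>UNIV. ennreal (t h / real CARD('i)) * indicator A (\<zeta> h i))"
proof -
  let ?\<mu> = "\<lambda>A. \<Sum>h\<in>UNIV. \<Sum>i\<in>UNIV.
      ennreal (t h / real CARD('i)) * emeasure (return (borel_on S) (\<zeta> h i)) A"
  have "emeasure (weighted_empirical S t \<zeta>) A = ?\<mu> A"
  proof (rule emeasure_measure_of[OF weighted_empirical_def])
    show "sets (borel_on S) \<subseteq> Pow S"
      using sets.space_closed[of "borel_on S"] by (simp add: space_restrict_space)
    show "positive (sets (weighted_empirical S t \<zeta>)) ?\<mu>"
      by (simp add: positive_def)
    show "countably_additive (sets (weighted_empirical S t \<zeta>)) ?\<mu>"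
    proof (rule countably_additiveI)
      fix B :: "nat \<Rightarrow> 'a set"
      assume B: "range B \<subseteq> sets (weighted_empirical S t \<zeta>)" "disjoint_family B"
      have "(\<Sum>k. emeasure (return (borel_on S) (\<zeta> h i)) (B k)) =
          emeasure (return (borel_on S) (\<zeta> h i)) (\<Union>k. B k)" for h i
        using B by (intro suminf_emeasure) auto
      then show "(\<Sum>k. ?\<mu> (B k)) = ?\<mu> (\<Union>k. B k)"
        by (simp add: suminf_sum)
    qed
  qed (use A in simp)
  also have "\<dots> = (\<Sum>h\<in>UNIV. \<Sum>i\<in>UNIV. ennreal (t h / real CARD('i)) * indicator A (\<zeta> h i))"
    using A by simp
  finally show ?thesis .
qed

subsection \<open>Objective and reformulation\<close>

definition loss ::
  "('n \<Rightarrow> 'j \<Rightarrow> real^'k \<Rightarrow> real^'m) \<Rightarrow> ('n \<Rightarrow> 'j \<Rightarrow> real^'k \<Rightarrow> real) \<Rightarrow>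
   real^'k \<Rightarrow> real^'m^'n \<Rightarrow> real" where
  "loss a b x \<xi> = (\<Sum>n\<in>UNIV. MAX j\<in>UNIV. a n j x \<bullet> (\<xi> $ n) + b n j x)"

definition worst_case ::
  "(real^'m^'n) measure set \<Rightarrow> (real^'m^'n \<Rightarrow> real) \<Rightarrow> ereal" where
  "worst_case B f = (SUP Q\<in>B. ereal (\<integral>\<xi>. f \<xi> \<partial>Q))"

text \<open>The term \<open>\<Sum>l<L n. \<gamma> h i j n l *\<^sub>R C n l\<close> is the transpose of \<open>C\<^sub>n\<close> applied to \<open>\<gamma>\<^sub>h\<^sub>i\<^sub>j\<^sub>n\<close>.\<close>

definition reform_feasible ::
  "(real^'m \<Rightarrow> real) \<Rightarrow> ('n::finite \<Rightarrow> nat) \<Rightarrow> ('n \<Rightarrow> nat \<Rightarrow> real^'m) \<Rightarrow> ('n \<Rightarrow> nat \<Rightarrow> real) \<Rightarrow>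
   ('n \<Rightarrow> 'j \<Rightarrow> real^'k \<Rightarrow> real^'m) \<Rightarrow> ('n \<Rightarrow> 'j \<Rightarrow> real^'k \<Rightarrow> real) \<Rightarrow>
   ('h \<Rightarrow> 'i \<Rightarrow> real^'m^'n) \<Rightarrow> real^'k \<Rightarrow>
   real \<Rightarrow> ('h \<Rightarrow> 'i \<Rightarrow> 'n \<Rightarrow> real) \<Rightarrow> ('h \<Rightarrow> 'i \<Rightarrow> 'j \<Rightarrow> 'n \<Rightarrow> nat \<Rightarrow> real) \<Rightarrow> bool" where
  "reform_feasible \<nu> L C g a b \<zeta> x lam s \<gamma> \<longleftrightarrow>
     (\<forall>h i j n.
        b n j x + a n j x \<bullet> (\<zeta> h i $ n)
          + (\<Sum>l<L n. \<gamma> h i j n l * (g n l - C n l \<bullet> (\<zeta> h i $ n))) \<le> s h i n \<and>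
        dual_norm \<nu> ((\<Sum>l<L n. \<gamma> h i j n l *\<^sub>R C n l) - a n j x) \<le> lam \<and>
        (\<forall>l<L n. 0 \<le> \<gamma> h i j n l))"

definition reform_objective ::
  "real \<Rightarrow> ('h::finite \<Rightarrow> real) \<Rightarrow> real \<Rightarrow> ('h \<Rightarrow> 'i::finite \<Rightarrow> 'n::finite \<Rightarrow> real) \<Rightarrow> real" where
  "reform_objective \<epsilon> t lam s =
     lam * \<epsilon> + (\<Sum>h\<in>UNIV. \<Sum>i\<in>UNIV. \<Sum>n\<in>UNIV. t h / real CARD('i) * s h i n)"

end

theory Submission
  imports Defs
begin

text \<open>
  Fix \<open>x\<close>, and write \<open>f\<^sub>n\<close> for the maximum of the affine pieces on block \<open>n\<close> and \<open>P\<^sub>n\<close> for the polytope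
  of that block. The identity is Lagrangian duality for the transport budget \<open>\<epsilon>\<close>, followed by a linear
  programming duality inside each block.

  The multipliers \<open>\<gamma>\<close> can be eliminated first: for given \<open>\<lambda>\<close> and \<open>s\<close> suitable \<open>\<gamma>\<close> exist if and only if
  \<open>\<lambda> \<ge> 0\<close> and \<open>f\<^sub>n u \<le> s\<^sub>h\<^sub>i\<^sub>n + \<lambda> \<nu> (u - \<zeta>\<^sub>h\<^sub>i\<^sub>n)\<close> for all \<open>u \<in> P\<^sub>n\<close> (\<open>reform_feasible_iff\<close>). One direction adds
  up the rows of \<open>C\<^sub>n u \<le> g\<^sub>n\<close> with weights \<open>\<gamma>\<close>. For the other, take an affine piece that is at most
  \<open>s + \<lambda> \<nu> (u - \<zeta>)\<close> on \<open>P\<^sub>n\<close>. Between the piece minus \<open>s\<close> and \<open>\<lambda> \<nu> (u - \<zeta>)\<close> there is a linear function of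
  \<open>u - \<zeta>\<close>. It lies below \<open>\<lambda> \<nu>\<close> everywhere, which is the dual norm constraint, and that it lies above
  the lowered piece is an affine inequality valid on \<open>P\<^sub>n\<close>, so Farkas' lemma derives it from the rows
  of \<open>C\<^sub>n u \<le> g\<^sub>n\<close> with nonnegative weights \<open>\<gamma>\<close>.

  \<^emph>\<open>The supremum is at most the infimum.\<close> Summing these inequalities over the blocks bounds the loss
  at \<open>\<xi>\<close> by \<open>\<Sum>\<^sub>n s\<^sub>h\<^sub>i\<^sub>n\<close> plus \<open>\<lambda>\<close> times the distance of \<open>\<xi>\<close> to the sample \<open>\<zeta>\<^sub>h\<^sub>i\<close>; this is integrated against
  a nearly optimal coupling (\<open>expectation_ambiguity_set_le\<close>).

  \<^emph>\<open>The infimum is at most the supremum.\<close> Only finitely supported distributions are needed. Those that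
  arise by moving the mass of the samples form a convex family, hence so do the pairs (transport cost,
  expected loss) in the plane. If the expected loss never exceeds \<open>y\<close> at cost at most \<open>\<epsilon>\<close>, a
  separating line provides a price \<open>\<mu> \<ge> 0\<close> such that the expected loss plus \<open>\<mu>\<close> times the unspent
  budget is at most \<open>y\<close> for all of them (\<open>exists_penalty\<close>). Moving each block of each sample to a
  maximiser of \<open>f\<^sub>n u - \<mu> \<nu> (u - \<zeta>\<^sub>h\<^sub>i\<^sub>n)\<close> over the compact set \<open>P\<^sub>n\<close> turns this penalised loss into the
  objective value at \<open>\<lambda> = \<mu>\<close>, with \<open>s\<^sub>h\<^sub>i\<^sub>n\<close> the maximal values. Separability of the loss and of the norm
  is what lets the blocks be maximised independently.
\<close>

section \<open>Norms on Euclidean spaces\<close>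

lemma is_norm_nonneg: "is_norm \<nu> \<Longrightarrow> 0 \<le> \<nu> u"
  by (simp add: is_norm_def)

lemma is_norm_zero: "is_norm \<nu> \<Longrightarrow> \<nu> 0 = 0"
  by (simp add: is_norm_def)

lemma is_norm_scaleR: "is_norm \<nu> \<Longrightarrow> \<nu> (c *\<^sub>R u) = \<bar>c\<bar> * \<nu> u"
  by (simp add: is_norm_def)

lemma is_norm_add: "is_norm \<nu> \<Longrightarrow> \<nu> (u + v) \<le> \<nu> u + \<nu> v"
  by (simp add: is_norm_def)

lemma is_norm_minus: "is_norm \<nu> \<Longrightarrow> \<nu> (- u) = \<nu> u"
  using is_norm_scaleR[of \<nu> "-1" u] by simp

lemma is_norm_convex: "is_norm \<nu> \<Longrightarrow> convex_on UNIV \<nu>"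
  unfolding is_norm_def by (intro convex_onI) (auto, smt (verit, ccfv_SIG))

lemma is_norm_continuous:
  fixes \<nu> :: "'a::euclidean_space \<Rightarrow> real"
  shows "is_norm \<nu> \<Longrightarrow> continuous_on UNIV \<nu>"
  by (intro convex_on_continuous is_norm_convex open_UNIV)

text \<open>
  The constant is the minimum of \<open>\<nu>\<close> over the Euclidean unit sphere, which is compact.
\<close>

lemma is_norm_ge_multiple_of_norm:
  fixes \<nu> :: "'a::euclidean_space \<Rightarrow> real"
  assumes \<nu>: "is_norm \<nu>"
  obtains k where "0 < k" "\<And>u. k * norm u \<le> \<nu> u"
proof -
  have "sphere (0::'a) 1 \<noteq> {}" by simp
  then obtain w where w: "w \<in> sphere (0::'a) 1" "\<And>u. u \<in> sphere 0 1 \<Longrightarrow> \<nu> w \<le> \<nu> u"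
    using continuous_attains_inf[OF compact_sphere _ continuous_on_subset[OF is_norm_continuous[OF \<nu>]]]
    by (metis subset_UNIV)
  have "\<nu> w \<noteq> 0" using \<nu> w(1) unfolding is_norm_def by auto
  then have pos: "0 < \<nu> w" using is_norm_nonneg[OF \<nu>, of w] by simp
  moreover have "\<nu> w * norm u \<le> \<nu> u" for u
  proof (cases "u = 0")
    case False
    then have "\<nu> w \<le> \<nu> ((1 / norm u) *\<^sub>R u)"
      by (intro w(2)) simp
    also have "\<dots> = \<nu> u / norm u"
      using is_norm_scaleR[OF \<nu>] by simp
    finally show ?thesis using False by (simp add: field_simps)
  qed (simp add: is_norm_zero[OF \<nu>])
  ultimately show ?thesis using that by blast
qed

text \<open>
  Comparison with the Euclidean norm bounds the set whose supremum is the dual norm; without it the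
  supremum would not dominate the elements of that set.
\<close>

lemma inner_le_dual_norm:
  fixes \<nu> :: "'a::euclidean_space \<Rightarrow> real"
  assumes \<nu>: "is_norm \<nu>"
  shows "v \<bullet> u \<le> dual_norm \<nu> v * \<nu> u"
proof (cases "u = 0")
  case False
  obtain k where k: "0 < k" "\<And>u. k * norm u \<le> \<nu> u"
    using is_norm_ge_multiple_of_norm[OF \<nu>] by blast
  have "v \<bullet> w \<le> norm v * (1 / k)" if "\<nu> w \<le> 1" for w
  proof -
    have "norm w \<le> 1 / k"
      using k(1) k(2)[of w] that by (simp add: field_simps)
    then show ?thesis
      by (intro order_trans[OF norm_cauchy_schwarz] mult_left_mono) auto
  qed
  then have bdd: "bdd_above ((\<lambda>w. v \<bullet> w) ` {w. \<nu> w \<le> 1})"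
    by (intro bdd_aboveI2) auto
  have pos: "0 < \<nu> u"
    using False \<nu> is_norm_nonneg[OF \<nu>, of u] unfolding is_norm_def by (metis order_le_less)
  have "\<nu> ((1 / \<nu> u) *\<^sub>R u) \<le> 1"
    using is_norm_scaleR[OF \<nu>, of "1 / \<nu> u" u] pos by simp
  then have "v \<bullet> ((1 / \<nu> u) *\<^sub>R u) \<le> dual_norm \<nu> v"
    unfolding dual_norm_def by (intro cSUP_upper bdd) simp
  then show ?thesis using pos by (simp add: field_simps)
qed (simp add: is_norm_zero[OF \<nu>])

lemma dual_norm_leI:
  assumes \<nu>: "is_norm \<nu>" and le: "\<And>u. v \<bullet> u \<le> \<mu> * \<nu> u" and \<mu>: "0 \<le> \<mu>"
  shows "dual_norm \<nu> v \<le> \<mu>"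
  unfolding dual_norm_def
proof (rule cSUP_least)
  show "{u. \<nu> u \<le> 1} \<noteq> {}" using is_norm_zero[OF \<nu>] by (metis (mono_tags) empty_Collect_eq zero_le_one)
  fix u assume "u \<in> {u. \<nu> u \<le> 1}"
  then have "\<mu> * \<nu> u \<le> \<mu>"
    using \<mu> by (simp add: mult_left_le)
  then show "v \<bullet> u \<le> \<mu>" using le[of u] by simp
qed

lemma dual_norm_nonneg:
  fixes \<nu> :: "'a::euclidean_space \<Rightarrow> real"
  assumes \<nu>: "is_norm \<nu>"
  shows "0 \<le> dual_norm \<nu> v"
proof -
  obtain u :: 'a where u: "u \<noteq> 0" by (metis SOME_Basis nonzero_Basis)
  have "0 < \<nu> u" using u \<nu> is_norm_nonneg[OF \<nu>, of u] unfolding is_norm_def by (metis order_le_less)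
  moreover have "0 \<le> dual_norm \<nu> v * \<nu> u"
    using inner_le_dual_norm[OF \<nu>, of v u] inner_le_dual_norm[OF \<nu>, of v "- u"]
    by (simp add: is_norm_minus[OF \<nu>])
  ultimately show ?thesis by (simp add: zero_le_mult_iff)
qed

lemma is_norm_norm_sum:
  assumes "is_norm \<nu>"
  shows "is_norm (norm_sum \<nu> :: real^'m^'n::finite \<Rightarrow> real)"
proof -
  have "norm_sum \<nu> u = 0 \<longleftrightarrow> u = 0" for u :: "real^'m^'n"
    using assms by (simp add: norm_sum_def sum_nonneg_eq_0_iff is_norm_def vec_eq_iff)
  moreover have "norm_sum \<nu> (u + v) \<le> norm_sum \<nu> u + norm_sum \<nu> v" for u v :: "real^'m^'n"
    unfolding norm_sum_def sum.distrib[symmetric] using assms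
    by (intro sum_mono) (simp add: is_norm_def)
  moreover have "0 \<le> norm_sum \<nu> u" and "norm_sum \<nu> (c *\<^sub>R u) = \<bar>c\<bar> * norm_sum \<nu> u" for c and u :: "real^'m^'n"
    using assms by (auto simp: norm_sum_def is_norm_def sum_nonneg sum_distrib_left)
  ultimately show ?thesis
    unfolding is_norm_def by blast
qed

section \<open>Convex duality by separating hyperplanes\<close>

text \<open>
  The affine form of Farkas' lemma. The cone generated by the \<open>(c l, d l)\<close> and \<open>(0, 1)\<close> is closed,
  being finitely generated; the extra generator absorbs the slack in \<open>r\<close>. A functional \<open>(v, y)\<close>
  separating \<open>(q, r)\<close> from it would refute the validity of \<open>q \<bullet> u \<le> r\<close>: at the point \<open>- v / y\<close> if
  \<open>y > 0\<close>, and far out on the ray from the feasible point \<open>u0\<close> in direction \<open>- v\<close> if \<open>y = 0\<close>.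
\<close>

lemma farkas_affine:
  fixes c :: "nat \<Rightarrow> 'a::euclidean_space"
  assumes feasible: "\<And>l. l < L \<Longrightarrow> c l \<bullet> u0 \<le> d l"
    and valid: "\<And>u. (\<And>l. l < L \<Longrightarrow> c l \<bullet> u \<le> d l) \<Longrightarrow> q \<bullet> u \<le> r"
  obtains \<gamma> where "\<And>l. 0 \<le> \<gamma> l" "(\<Sum>l<L. \<gamma> l *\<^sub>R c l) = q" "(\<Sum>l<L. \<gamma> l * d l) \<le> r"
proof -
  define K where "K = convex_cone hull (insert (0, 1) ((\<lambda>l. (c l, d l)) ` {..<L}))"
  have gen: "(c l, d l) \<in> K" if "l < L" for l
    unfolding K_def using that by (intro hull_inc) auto
  have gen1: "(0, 1) \<in> K"
    unfolding K_def by (intro hull_inc) auto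
  have K: "convex K" "closed K" "0 \<in> K" "\<And>z s. z \<in> K \<Longrightarrow> 0 \<le> s \<Longrightarrow> s *\<^sub>R z \<in> K"
    unfolding K_def
    by (auto intro: convex_convex_cone_hull closed_convex_cone_hull convex_cone_hull_contains_0
        convex_cone_hull_mul)
  have "(q, r) \<in> K"
  proof (rule ccontr)
    assume "(q, r) \<notin> K"
    then obtain p \<beta> where p: "p \<bullet> (q, r) < \<beta>" "\<And>z. z \<in> K \<Longrightarrow> \<beta> < p \<bullet> z"
      using separating_hyperplane_closed_point[OF K(1,2)] by blast
    obtain v y where vy: "p = (v, y)" by (cases p)
    have \<beta>: "\<beta> < 0"
      using p(2)[OF K(3)] by simp
    \<comment> \<open>A functional bounded below on a cone is nonnegative there.\<close>
    have nonneg: "0 \<le> p \<bullet> z" if "z \<in> K" for z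
    proof (rule ccontr)
      assume neg: "\<not> 0 \<le> p \<bullet> z"
      define s where "s = \<beta> / (p \<bullet> z)"
      have "0 \<le> s"
        using neg \<beta> by (simp add: s_def divide_nonpos_neg)
      then have "\<beta> < p \<bullet> (s *\<^sub>R z)"
        using K(4)[OF that] p(2) by blast
      then show False
        using neg by (simp add: s_def)
    qed
    have y: "0 \<le> y" and row: "\<And>l. l < L \<Longrightarrow> 0 \<le> v \<bullet> c l + y * d l"
      using nonneg[OF gen1] nonneg[OF gen] by (auto simp: vy)
    have neg: "v \<bullet> q + y * r < 0"
      using p(1) \<beta> by (simp add: vy)
    show False
    proof (cases "y = 0")
      case False
      with y have y: "0 < y" by simp
      have "c l \<bullet> (- (1 / y) *\<^sub>R v) \<le> d l" if "l < L" for l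
        using row[OF that] y by (simp add: field_simps inner_commute)
      then have "q \<bullet> (- (1 / y) *\<^sub>R v) \<le> r"
        by (rule valid)
      then show False
        using neg y by (simp add: field_simps inner_commute)
    next
      case True
      \<comment> \<open>Here \<open>- v\<close> is a recession direction along which \<open>q\<close> grows.\<close>
      define s where "s = (\<bar>r - q \<bullet> u0\<bar> + 1) / (- (v \<bullet> q))"
      have s: "0 \<le> s"
        using neg True by (simp add: s_def divide_nonneg_neg divide_nonneg_pos)
      have "c l \<bullet> (u0 - s *\<^sub>R v) \<le> d l" if "l < L" for l
      proof -
        have "0 \<le> s * (v \<bullet> c l)"
          using row[OF that] True s by simp
        then show ?thesis
          using feasible[OF that] by (simp add: inner_diff_right inner_commute)
      qed
      then have "q \<bullet> (u0 - s *\<^sub>R v) \<le> r"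
        by (rule valid)
      moreover have "s * (v \<bullet> q) = - (\<bar>r - q \<bullet> u0\<bar> + 1)"
        using neg True by (simp add: s_def)
      ultimately show False
        by (simp add: inner_diff_right inner_commute)
    qed
  qed
  moreover have "K \<subseteq> {(\<Sum>l<L. \<gamma> l *\<^sub>R c l, (\<Sum>l<L. \<gamma> l * d l) + \<rho>) | \<gamma> \<rho>. (\<forall>l. 0 \<le> \<gamma> l) \<and> 0 \<le> \<rho>}"
    (is "_ \<subseteq> ?R")
    unfolding K_def
  proof (rule hull_minimal)
    have "(0, 1) \<in> ?R"
      by (rule CollectI, rule exI[of _ "\<lambda>_. 0"], rule exI[of _ 1]) simp
    moreover have "(c l, d l) \<in> ?R" if "l < L" for l
      using that
      by (intro CollectI exI[of _ "\<lambda>k. if k = l then 1 else 0"] exI[of _ 0])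
         (simp add: if_distrib[of "\<lambda>s. s *\<^sub>R _"] if_distrib[of "\<lambda>s. s * _"] cong: if_cong)
    ultimately show "insert (0, 1) ((\<lambda>l. (c l, d l)) ` {..<L}) \<subseteq> ?R"
      by blast
    have "0 \<in> ?R"
      by (rule CollectI, rule exI[of _ "\<lambda>_. 0"], rule exI[of _ 0]) (simp add: zero_prod_def)
    moreover have "z + z' \<in> ?R" if z: "z \<in> ?R" and z': "z' \<in> ?R" for z z'
    proof -
      obtain \<gamma> \<rho> where
        "z = (\<Sum>l<L. \<gamma> l *\<^sub>R c l, (\<Sum>l<L. \<gamma> l * d l) + \<rho>)" "\<forall>l. 0 \<le> \<gamma> l" "0 \<le> \<rho>"
        using z by blast
      moreover obtain \<gamma>' \<rho>' where
        "z' = (\<Sum>l<L. \<gamma>' l *\<^sub>R c l, (\<Sum>l<L. \<gamma>' l * d l) + \<rho>')" "\<forall>l. 0 \<le> \<gamma>' l" "0 \<le> \<rho>'"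
        using z' by blast
      ultimately show ?thesis
        by (intro CollectI exI[of _ "\<lambda>l. \<gamma> l + \<gamma>' l"] exI[of _ "\<rho> + \<rho>'"])
           (simp add: algebra_simps sum.distrib)
    qed
    moreover have "s *\<^sub>R z \<in> ?R" if z: "z \<in> ?R" and s: "0 \<le> s" for z s
    proof -
      obtain \<gamma> \<rho> where
        "z = (\<Sum>l<L. \<gamma> l *\<^sub>R c l, (\<Sum>l<L. \<gamma> l * d l) + \<rho>)" "\<forall>l. 0 \<le> \<gamma> l" "0 \<le> \<rho>"
        using z by blast
      then show ?thesis
        using s
        by (intro CollectI exI[of _ "\<lambda>l. s * \<gamma> l"] exI[of _ "s * \<rho>"])
           (simp add: algebra_simps sum_distrib_left scaleR_sum_right)
    qed
    ultimately show "convex_cone ?R"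
      unfolding convex_cone_iff by blast
  qed
  ultimately obtain \<gamma> \<rho> where "\<forall>l. 0 \<le> \<gamma> l" "0 \<le> \<rho>" "(\<Sum>l<L. \<gamma> l *\<^sub>R c l) = q" "(\<Sum>l<L. \<gamma> l * d l) + \<rho> = r"
    by (smt (verit) Pair_inject mem_Collect_eq subsetD)
  then show ?thesis
    using that[of \<gamma>] by force
qed

text \<open>
  A Hahn--Banach sandwich: the graph of the affine function over \<open>U\<close>, with everything below it, is
  separated from the strict epigraph of \<open>\<mu> * \<nu>\<close>, and the hyperplane through the origin with the same
  slope is the graph of \<open>w\<close>. It cannot be vertical because the epigraph lies over the whole space.
\<close>

lemma sandwich_linear:
  fixes \<nu> :: "'a::euclidean_space \<Rightarrow> real"
  assumes \<nu>: "is_norm \<nu>" and \<mu>: "0 \<le> \<mu>" and U: "convex U" "U \<noteq> {}"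
    and below: "\<And>u. u \<in> U \<Longrightarrow> a \<bullet> u - r \<le> \<mu> * \<nu> u"
  obtains w where "\<And>u. w \<bullet> u \<le> \<mu> * \<nu> u" "\<And>u. u \<in> U \<Longrightarrow> a \<bullet> u - r \<le> w \<bullet> u"
proof -
  define S where "S = {(u, y). u \<in> U \<and> y \<le> a \<bullet> u - r}"
  define T where "T = {(u, y). \<mu> * \<nu> u < y}"
  have "convex S"
  proof -
    have "S = (U \<times> UNIV) \<inter> {z. (- a, 1) \<bullet> z \<le> - r}"
      by (auto simp: S_def)
    then show ?thesis
      using U(1) by (auto intro!: convex_Int convex_Times convex_halfspace_le)
  qed
  moreover have "convex T"
  proof (rule convexI)
    fix x y :: "'a \<times> real" and s t :: real
    assume xy: "x \<in> T" "y \<in> T" and st: "0 \<le> s" "0 \<le> t" "s + t = 1"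
    have "\<mu> * \<nu> (s *\<^sub>R fst x + t *\<^sub>R fst y) \<le> \<mu> * (s * \<nu> (fst x) + t * \<nu> (fst y))"
      using is_norm_add[OF \<nu>, of "s *\<^sub>R fst x" "t *\<^sub>R fst y"] \<mu> st
      by (intro mult_left_mono) (simp_all add: is_norm_scaleR[OF \<nu>])
    also have "\<dots> = s * (\<mu> * \<nu> (fst x)) + t * (\<mu> * \<nu> (fst y))"
      by (simp add: algebra_simps)
    also have "\<dots> < s * snd x + t * snd y"
    proof (cases "s = 0")
      case True
      then show ?thesis using xy st by (simp add: T_def split_beta)
    next
      case False
      then have "s * (\<mu> * \<nu> (fst x)) < s * snd x"
        using xy st by (simp add: T_def split_beta)
      moreover have "t * (\<mu> * \<nu> (fst y)) \<le> t * snd y"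
        using xy st by (intro mult_left_mono) (simp_all add: T_def split_beta)
      ultimately show ?thesis by simp
    qed
    finally show "s *\<^sub>R x + t *\<^sub>R y \<in> T"
      by (simp add: T_def split_beta)
  qed
  moreover have "S \<noteq> {}" using U(2) by (auto simp: S_def)
  moreover have "T \<noteq> {}"
    unfolding T_def by (auto intro: gt_ex)
  moreover have "S \<inter> T = {}"
    using below by (force simp: S_def T_def)
  ultimately obtain p d where p: "p \<noteq> 0" "\<And>x. x \<in> S \<Longrightarrow> p \<bullet> x \<le> d" "\<And>x. x \<in> T \<Longrightarrow> d \<le> p \<bullet> x"
    using separating_hyperplane_sets by metis
  obtain v \<beta> where vb: "p = (v, \<beta>)" by (cases p)
  have on_S: "v \<bullet> u + \<beta> * y \<le> d" if "u \<in> U" "y \<le> a \<bullet> u - r" for u y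
    using p(2)[of "(u, y)"] that by (simp add: vb S_def)
  have on_T: "d \<le> v \<bullet> u + \<beta> * y" if "\<mu> * \<nu> u < y" for u y
    using p(3)[of "(u, y)"] that by (simp add: vb T_def)
  have \<beta>: "0 \<le> \<beta>"
  proof (rule ccontr)
    assume "\<not> 0 \<le> \<beta>"
    then have neg: "\<beta> < 0" by simp
    define s where "s = (\<bar>d\<bar> + 1) / (- \<beta>)"
    have "\<beta> * s = - (\<bar>d\<bar> + 1)" and "0 < s"
      using neg by (simp_all add: s_def divide_pos_pos divide_pos_neg)
    then show False
      using on_T[of 0 s] by (simp add: is_norm_zero[OF \<nu>])
  qed
  have "\<beta> \<noteq> 0"
  proof
    assume 0: "\<beta> = 0"
    have all: "d \<le> v \<bullet> u" for u
      using on_T[of u "\<mu> * \<nu> u + 1"] 0 by simp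
    obtain u where "u \<in> U" using U(2) by blast
    have v: "v \<noteq> 0" using p(1) 0 by (auto simp: vb zero_prod_def)
    have "d \<le> v \<bullet> (((d - 1) / (v \<bullet> v)) *\<^sub>R v)" by (rule all)
    then show False using v by simp
  qed
  with \<beta> have \<beta>: "0 < \<beta>" by simp
  have lim: "d \<le> v \<bullet> u + \<beta> * (\<mu> * \<nu> u)" for u
  proof (rule field_le_epsilon)
    fix e :: real assume "0 < e"
    then show "d \<le> v \<bullet> u + \<beta> * (\<mu> * \<nu> u) + e"
      using on_T[of u "\<mu> * \<nu> u + e / \<beta>"] \<beta> by (simp add: distrib_left)
  qed
  have d: "d \<le> 0"
    using lim[of 0] by (simp add: is_norm_zero[OF \<nu>])
  \<comment> \<open>The upper function is positively homogeneous, so the bound improves from \<open>d\<close> to \<open>0\<close>.\<close>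
  have cone: "0 \<le> v \<bullet> u + \<beta> * (\<mu> * \<nu> u)" for u
  proof (rule ccontr)
    define e where "e = v \<bullet> u + \<beta> * (\<mu> * \<nu> u)"
    assume "\<not> 0 \<le> v \<bullet> u + \<beta> * (\<mu> * \<nu> u)"
    then have neg: "e < 0" by (simp add: e_def)
    define s where "s = (d - 1) / e"
    have s: "0 \<le> s" "s * e = d - 1"
      using neg d by (simp_all add: s_def divide_nonpos_neg)
    have "d \<le> s * e"
      using lim[of "s *\<^sub>R u"] s(1) by (simp add: is_norm_scaleR[OF \<nu>] e_def algebra_simps)
    then show False using s(2) by simp
  qed
  show ?thesis
  proof (rule that)
    show "(- (1 / \<beta>) *\<^sub>R v) \<bullet> u \<le> \<mu> * \<nu> u" for u
      using cone[of u] \<beta> by (simp add: field_simps)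
    show "a \<bullet> u - r \<le> (- (1 / \<beta>) *\<^sub>R v) \<bullet> u" if "u \<in> U" for u
    proof -
      have "v \<bullet> u + \<beta> * (a \<bullet> u - r) \<le> 0"
        using on_S[OF that order_refl] d by simp
      then show ?thesis using \<beta> by (simp add: field_simps)
    qed
  qed
qed

text \<open>
  \<open>A\<close> is a set of pairs (cost, value). The multiplier is the slope of a line separating \<open>A\<close> from the
  quadrant of costs at most \<open>\<epsilon>\<close> and values above \<open>z\<close>; the point with cost \<open>c0 < \<epsilon>\<close> is the Slater
  condition, which rules out a vertical line.
\<close>

lemma lagrange_multiplier:
  fixes A :: "(real \<times> real) set"
  assumes A: "convex A" and slater: "(c0, v0) \<in> A" "c0 < \<epsilon>"
    and bound: "\<And>c v. (c, v) \<in> A \<Longrightarrow> c \<le> \<epsilon> \<Longrightarrow> v \<le> z"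
  obtains \<mu> where "0 \<le> \<mu>" "\<And>c v. (c, v) \<in> A \<Longrightarrow> v + \<mu> * (\<epsilon> - c) \<le> z"
proof -
  define T where "T = {..\<epsilon>} \<times> {z<..}"
  have T: "convex T" "T \<noteq> {}"
    unfolding T_def by (auto intro!: convex_Times convex_real_interval)
  have "A \<inter> T = {}"
    using bound by (force simp: T_def)
  then obtain p d where p: "p \<noteq> 0" "\<And>x. x \<in> A \<Longrightarrow> p \<bullet> x \<le> d" "\<And>x. x \<in> T \<Longrightarrow> d \<le> p \<bullet> x"
    using separating_hyperplane_sets[OF A T(1) _ T(2)] slater(1) by blast
  obtain \<alpha> \<beta> where ab: "p = (\<alpha>, \<beta>)" by (cases p)
  have on_A: "\<alpha> * c + \<beta> * v \<le> d" if "(c, v) \<in> A" for c v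
    using p(2)[OF that] by (simp add: ab)
  have on_T: "d \<le> \<alpha> * c + \<beta> * v" if "c \<le> \<epsilon>" "z < v" for c v
    using p(3)[of "(c, v)"] that by (simp add: ab T_def)
  have \<alpha>: "\<alpha> \<le> 0"
  proof (rule ccontr)
    assume "\<not> \<alpha> \<le> 0"
    then have pos: "0 < \<alpha>" by simp
    define s where "s = (\<bar>\<alpha> * \<epsilon> + \<beta> * (z + 1) - d\<bar> + 1) / \<alpha>"
    have "\<alpha> * s = \<bar>\<alpha> * \<epsilon> + \<beta> * (z + 1) - d\<bar> + 1" and "0 \<le> s"
      using pos by (simp_all add: s_def)
    then show False
      using on_T[of "\<epsilon> - s" "z + 1"] by (simp add: right_diff_distrib)
  qed
  have \<beta>: "0 \<le> \<beta>"
  proof (rule ccontr)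
    assume "\<not> 0 \<le> \<beta>"
    then have neg: "\<beta> < 0" by simp
    define s where "s = (\<bar>\<alpha> * \<epsilon> + \<beta> * (z + 1) - d\<bar> + 1) / (- \<beta>)"
    have "\<beta> * s = - (\<bar>\<alpha> * \<epsilon> + \<beta> * (z + 1) - d\<bar> + 1)" and "0 \<le> s"
      using neg by (simp_all add: s_def divide_nonneg_pos divide_nonneg_neg)
    then show False
      using on_T[of \<epsilon> "z + 1 + s"] by (simp add: distrib_left)
  qed
  \<comment> \<open>A vertical separating line would pass between \<open>c0\<close> and \<open>\<epsilon>\<close> the wrong way round.\<close>
  have "\<beta> \<noteq> 0"
  proof
    assume 0: "\<beta> = 0"
    with \<alpha> p(1) have "\<alpha> < 0"
      by (auto simp: ab zero_prod_def)
    moreover have "\<alpha> * c0 \<le> \<alpha> * \<epsilon>"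
      using on_A[OF slater(1)] on_T[of \<epsilon> "z + 1"] 0 by simp
    ultimately show False
      using slater(2) by simp
  qed
  with \<beta> have \<beta>: "0 < \<beta>" by simp
  have corner: "d \<le> \<alpha> * \<epsilon> + \<beta> * z"
  proof (rule field_le_epsilon)
    fix e :: real assume "0 < e"
    then show "d \<le> \<alpha> * \<epsilon> + \<beta> * z + e"
      using on_T[of \<epsilon> "z + e / \<beta>"] \<beta> by (simp add: distrib_left)
  qed
  show ?thesis
  proof (rule that)
    show "0 \<le> - \<alpha> / \<beta>"
      using \<alpha> \<beta> by (simp add: divide_nonpos_pos)
    fix c v assume "(c, v) \<in> A"
    from on_A[OF this] corner have "\<alpha> * c + \<beta> * v \<le> \<alpha> * \<epsilon> + \<beta> * z"
      by simp
    then show "v + - \<alpha> / \<beta> * (\<epsilon> - c) \<le> z"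
      using \<beta> by (simp add: field_simps)
  qed
qed

section \<open>Elimination of the multipliers\<close>

text \<open>
  The rows of \<open>C\<close> weighted with \<open>\<gamma>\<close> bound the part \<open>\<Sum>\<gamma>\<^sub>l C\<^sub>l\<close> of the slope on the polyhedron; the rest
  of the slope has dual norm at most \<open>\<mu>\<close> and is paid for by \<open>\<mu> * \<nu> (\<xi> - \<zeta>)\<close>.
\<close>

lemma affine_le_of_multiplier:
  fixes c :: "real^'m"
  assumes \<nu>: "is_norm \<nu>" and \<xi>: "\<xi> \<in> polyhedral_set L C g"
    and \<gamma>: "\<And>l. l < L \<Longrightarrow> 0 \<le> \<gamma> l"
    and val: "d + c \<bullet> \<zeta> + (\<Sum>l<L. \<gamma> l * (g l - C l \<bullet> \<zeta>)) \<le> s"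
    and slope: "dual_norm \<nu> ((\<Sum>l<L. \<gamma> l *\<^sub>R C l) - c) \<le> \<mu>"
  shows "c \<bullet> \<xi> + d \<le> s + \<mu> * \<nu> (\<xi> - \<zeta>)"
proof -
  let ?q = "\<Sum>l<L. \<gamma> l *\<^sub>R C l"
  have "?q \<bullet> (\<xi> - \<zeta>) = (\<Sum>l<L. \<gamma> l * (C l \<bullet> \<xi> - C l \<bullet> \<zeta>))"
    by (simp add: inner_sum_left inner_diff_right right_diff_distrib sum_subtractf)
  also have "\<dots> \<le> (\<Sum>l<L. \<gamma> l * (g l - C l \<bullet> \<zeta>))"
    using \<gamma> \<xi> by (intro sum_mono mult_left_mono) (auto simp: polyhedral_set_def)
  finally have "?q \<bullet> (\<xi> - \<zeta>) \<le> s - d - c \<bullet> \<zeta>"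
    using val by simp
  moreover have "(?q - c) \<bullet> (\<zeta> - \<xi>) \<le> \<mu> * \<nu> (\<xi> - \<zeta>)"
  proof -
    have "(?q - c) \<bullet> (\<zeta> - \<xi>) \<le> dual_norm \<nu> (?q - c) * \<nu> (\<xi> - \<zeta>)"
      using inner_le_dual_norm[OF \<nu>, of "?q - c" "\<zeta> - \<xi>"] is_norm_minus[OF \<nu>, of "\<xi> - \<zeta>"] by simp
    also have "\<dots> \<le> \<mu> * \<nu> (\<xi> - \<zeta>)"
      using slope is_norm_nonneg[OF \<nu>] by (rule mult_right_mono)
    finally show ?thesis .
  qed
  ultimately show ?thesis
    by (simp add: inner_diff_left inner_diff_right)
qed

text \<open>
  Converse of the preceding lemma. The slope \<open>c\<close> is split as \<open>(c - w) + w\<close>, where \<open>w\<close> comes from the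
  sandwich theorem around \<open>\<zeta>\<close> and Farkas' lemma is applied to \<open>c - w\<close>.
\<close>

lemma multiplier_of_affine_le:
  fixes c :: "real^'m"
  assumes \<nu>: "is_norm \<nu>" and \<zeta>: "\<zeta> \<in> polyhedral_set L C g" and \<mu>: "0 \<le> \<mu>"
    and le: "\<And>\<xi>. \<xi> \<in> polyhedral_set L C g \<Longrightarrow> c \<bullet> \<xi> + d \<le> s + \<mu> * \<nu> (\<xi> - \<zeta>)"
  obtains \<gamma> where "\<And>l. 0 \<le> \<gamma> l"
    and "d + c \<bullet> \<zeta> + (\<Sum>l<L. \<gamma> l * (g l - C l \<bullet> \<zeta>)) \<le> s"
    and "dual_norm \<nu> ((\<Sum>l<L. \<gamma> l *\<^sub>R C l) - c) \<le> \<mu>"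
proof -
  define U where "U = {u. \<forall>l<L. C l \<bullet> u \<le> g l - C l \<bullet> \<zeta>}"
  define r where "r = s - d - c \<bullet> \<zeta>"
  have shift: "u \<in> U \<longleftrightarrow> \<zeta> + u \<in> polyhedral_set L C g" for u
    by (simp add: U_def polyhedral_set_def inner_add_right le_diff_eq add.commute)
  have "U = (\<Inter>l\<in>{..<L}. {u. C l \<bullet> u \<le> g l - C l \<bullet> \<zeta>})"
    by (auto simp: U_def)
  then have U: "convex U"
    by (simp add: convex_INT convex_halfspace_le)
  have 0: "0 \<in> U"
    using \<zeta> by (simp add: shift)
  have "c \<bullet> u - r \<le> \<mu> * \<nu> u" if "u \<in> U" for u
    using le[of "\<zeta> + u"] that by (simp add: shift r_def inner_add_right)
  then obtain w where w: "\<And>u. w \<bullet> u \<le> \<mu> * \<nu> u" "\<And>u. u \<in> U \<Longrightarrow> c \<bullet> u - r \<le> w \<bullet> u"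
    using sandwich_linear[OF \<nu> \<mu> U] 0 by (metis empty_iff)
  have "C l \<bullet> 0 \<le> g l - C l \<bullet> \<zeta>" if "l < L" for l
    using 0 that by (simp add: U_def)
  moreover have "(c - w) \<bullet> u \<le> r" if "\<And>l. l < L \<Longrightarrow> C l \<bullet> u \<le> g l - C l \<bullet> \<zeta>" for u
    using w(2)[of u] that by (simp add: U_def inner_diff_left)
  ultimately obtain \<gamma> where \<gamma>: "\<And>l. 0 \<le> \<gamma> l" "(\<Sum>l<L. \<gamma> l *\<^sub>R C l) = c - w"
      "(\<Sum>l<L. \<gamma> l * (g l - C l \<bullet> \<zeta>)) \<le> r"
    by (rule farkas_affine[of L C 0 "\<lambda>l. g l - C l \<bullet> \<zeta>" "c - w" r]) blast+
  have "- w \<bullet> u \<le> \<mu> * \<nu> u" for u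
    using w(1)[of "- u"] by (simp add: is_norm_minus[OF \<nu>])
  then have "dual_norm \<nu> (- w) \<le> \<mu>"
    by (rule dual_norm_leI[OF \<nu> _ \<mu>])
  then show ?thesis
    using that[of \<gamma>] \<gamma> by (simp add: r_def)
qed

definition block_loss ::
  "('n \<Rightarrow> 'j \<Rightarrow> real^'k \<Rightarrow> real^'m) \<Rightarrow> ('n \<Rightarrow> 'j \<Rightarrow> real^'k \<Rightarrow> real) \<Rightarrow> real^'k \<Rightarrow> 'n \<Rightarrow> real^'m \<Rightarrow> real"
  where "block_loss a b x n u = (MAX j\<in>UNIV. a n j x \<bullet> u + b n j x)"

lemma loss_eq_sum_block_loss: "loss a b x \<xi> = (\<Sum>n\<in>UNIV. block_loss a b x n (\<xi> $ n))"
  by (simp add: loss_def block_loss_def)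

lemma block_loss_le_iff:
  fixes a :: "'n \<Rightarrow> 'j::finite \<Rightarrow> real^'k \<Rightarrow> real^'m"
  shows "block_loss a b x n u \<le> y \<longleftrightarrow> (\<forall>j. a n j x \<bullet> u + b n j x \<le> y)"
  by (simp add: block_loss_def)

lemma continuous_on_block_loss:
  fixes a :: "'n \<Rightarrow> 'j::finite \<Rightarrow> real^'k \<Rightarrow> real^'m"
  shows "continuous_on S (block_loss a b x n)"
proof -
  have "continuous_on S (\<lambda>u. MAX j\<in>J. a n j x \<bullet> u + b n j x)" if "finite J" "J \<noteq> {}" for J
    using that by (induction rule: finite_ne_induct) (auto intro!: continuous_intros)
  then show ?thesis
    unfolding block_loss_def[abs_def] by simp
qed

text \<open>
  Solvability in \<open>\<gamma>\<close> means that \<open>s h i n\<close> dominates the penalised block loss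
  \<open>block_loss a b x n u - lam * \<nu> (u - \<zeta> h i $ n)\<close> over the whole polyhedron. The rest of the proof
  works with this semi-infinite form only.
\<close>

lemma reform_feasible_iff:
  fixes a :: "'n::finite \<Rightarrow> 'j::finite \<Rightarrow> real^'k \<Rightarrow> real^'m"
    and \<zeta> :: "'h::finite \<Rightarrow> 'i::finite \<Rightarrow> real^'m^'n"
  assumes \<nu>: "is_norm \<nu>"
    and \<zeta>: "\<And>h i n. \<zeta> h i $ n \<in> polyhedral_set (L n) (C n) (g n)"
  shows "(\<exists>\<gamma>. reform_feasible \<nu> L C g a b \<zeta> x lam s \<gamma>) \<longleftrightarrow>
    0 \<le> lam \<and> (\<forall>h i n. \<forall>u\<in>polyhedral_set (L n) (C n) (g n).
        block_loss a b x n u \<le> s h i n + lam * \<nu> (u - \<zeta> h i $ n))"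
proof (intro iffI conjI allI ballI; (elim exE conjE)?)
  fix \<gamma> assume feas: "reform_feasible \<nu> L C g a b \<zeta> x lam s \<gamma>"
  then have "dual_norm \<nu> ((\<Sum>l<L n. \<gamma> h i j n l *\<^sub>R C n l) - a n j x) \<le> lam" for h i j n
    by (simp add: reform_feasible_def)
  then show "0 \<le> lam"
    using dual_norm_nonneg[OF \<nu>] order_trans by blast
  fix h i n u assume u: "u \<in> polyhedral_set (L n) (C n) (g n)"
  show "block_loss a b x n u \<le> s h i n + lam * \<nu> (u - \<zeta> h i $ n)"
    unfolding block_loss_le_iff
  proof
    fix j
    show "a n j x \<bullet> u + b n j x \<le> s h i n + lam * \<nu> (u - \<zeta> h i $ n)"
      using feas by (intro affine_le_of_multiplier[OF \<nu> u, of "\<gamma> h i j n"]) (simp_all add: reform_feasible_def)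
  qed
next
  assume lam: "0 \<le> lam" and le: "\<forall>h i n. \<forall>u\<in>polyhedral_set (L n) (C n) (g n).
        block_loss a b x n u \<le> s h i n + lam * \<nu> (u - \<zeta> h i $ n)"
  define good where "good h i j n \<gamma> \<longleftrightarrow> (\<forall>l. 0 \<le> \<gamma> l) \<and>
      b n j x + a n j x \<bullet> (\<zeta> h i $ n) + (\<Sum>l<L n. \<gamma> l * (g n l - C n l \<bullet> (\<zeta> h i $ n))) \<le> s h i n \<and>
      dual_norm \<nu> ((\<Sum>l<L n. \<gamma> l *\<^sub>R C n l) - a n j x) \<le> lam" for h i j n \<gamma>
  have "\<exists>\<gamma>. good h i j n \<gamma>" for h i j n
    unfolding good_def
    by (rule multiplier_of_affine_le[OF \<nu> \<zeta>[of h i n] lam, where c = "a n j x" and d = "b n j x"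
          and s = "s h i n"])
       (use le in \<open>auto simp: block_loss_le_iff\<close>)
  then have "good h i j n (SOME \<gamma>. good h i j n \<gamma>)" for h i j n
    by (rule someI_ex)
  then have "reform_feasible \<nu> L C g a b \<zeta> x lam s (\<lambda>h i j n. SOME \<gamma>. good h i j n \<gamma>)"
    unfolding good_def reform_feasible_def by blast
  then show "\<exists>\<gamma>. reform_feasible \<nu> L C g a b \<zeta> x lam s \<gamma>"
    by blast
qed

lemma loss_lipschitz:
  fixes a :: "'n::finite \<Rightarrow> 'j::finite \<Rightarrow> real^'k \<Rightarrow> real^'m"
  assumes \<nu>: "is_norm \<nu>"
  obtains K where "0 \<le> K" "\<And>\<xi> \<xi>'. loss a b x \<xi> \<le> loss a b x \<xi>' + K * norm_sum \<nu> (\<xi> - \<xi>')"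
proof -
  define K where "K = (\<Sum>n\<in>UNIV. \<Sum>j\<in>UNIV. dual_norm \<nu> (a n j x))"
  have le_K: "dual_norm \<nu> (a n j x) \<le> K" for n j
  proof -
    have "dual_norm \<nu> (a n j x) \<le> (\<Sum>j\<in>UNIV. dual_norm \<nu> (a n j x))"
      by (rule member_le_sum) (simp_all add: dual_norm_nonneg[OF \<nu>])
    also have "\<dots> \<le> K"
      unfolding K_def
      by (rule member_le_sum[of n UNIV "\<lambda>n. \<Sum>j\<in>UNIV. dual_norm \<nu> (a n j x)"])
        (simp_all add: dual_norm_nonneg[OF \<nu>] sum_nonneg)
    finally show ?thesis .
  qed
  have "block_loss a b x n u \<le> block_loss a b x n u' + K * \<nu> (u - u')" for n u u'
    unfolding block_loss_le_iff
  proof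
    fix j
    have "a n j x \<bullet> u' + b n j x \<le> block_loss a b x n u'"
      using block_loss_le_iff[of a b x n u'] by blast
    moreover have "a n j x \<bullet> (u - u') \<le> dual_norm \<nu> (a n j x) * \<nu> (u - u')"
      by (rule inner_le_dual_norm[OF \<nu>])
    moreover have "\<dots> \<le> K * \<nu> (u - u')"
      using le_K is_norm_nonneg[OF \<nu>] by (rule mult_right_mono)
    ultimately show "a n j x \<bullet> u + b n j x \<le> block_loss a b x n u' + K * \<nu> (u - u')"
      by (simp add: inner_diff_right)
  qed
  then have "loss a b x \<xi> \<le> loss a b x \<xi>' + K * norm_sum \<nu> (\<xi> - \<xi>')" for \<xi> \<xi>'
    by (simp add: loss_eq_sum_block_loss norm_sum_def sum_distrib_left sum.distrib[symmetric] sum_mono)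
  moreover have "0 \<le> K"
    unfolding K_def by (intro sum_nonneg dual_norm_nonneg[OF \<nu>])
  ultimately show ?thesis using that by blast
qed

section \<open>Finitely supported transport plans\<close>

abbreviation discrete_law :: "'a::topological_space set \<Rightarrow> 'k pmf \<Rightarrow> ('k \<Rightarrow> 'a) \<Rightarrow> 'a measure" where
  "discrete_law S w z \<equiv> distr (measure_pmf w) (borel_on S) z"

definition sample_pmf :: "('h::finite \<Rightarrow> real) \<Rightarrow> ('h \<times> 'i::finite) pmf" where
  "sample_pmf t = embed_pmf (\<lambda>(h, i). t h / real CARD('i))"

lemma pmf_sample_pmf:
  fixes t :: "'h::finite \<Rightarrow> real"
  assumes "\<And>h. 0 \<le> t h" "(\<Sum>h\<in>UNIV. t h) = 1"
  shows "pmf (sample_pmf t :: ('h \<times> 'i::finite) pmf) (h, i) = t h / real CARD('i)"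
proof -
  have "(\<Sum>k\<in>UNIV. (\<lambda>(h, i::'i). t h / real CARD('i)) k) =
      (\<Sum>h\<in>UNIV. \<Sum>i\<in>(UNIV::'i set). t h / real CARD('i))"
    by (simp only: sum.cartesian_product UNIV_Times_UNIV)
  also have "\<dots> = 1"
    using assms(2) by simp
  finally have 1: "(\<Sum>k\<in>UNIV. (\<lambda>(h, i::'i). t h / real CARD('i)) k) = 1" .
  have "(\<integral>\<^sup>+ k. ennreal ((\<lambda>(h, i::'i). t h / real CARD('i)) k) \<partial>count_space UNIV) = 1"
    using assms(1) 1 by (subst nn_integral_count_space_finite) (auto simp: sum_ennreal case_prod_unfold)
  then have "pmf (sample_pmf t) (h, i :: 'i) = (\<lambda>(h, i::'i). t h / real CARD('i)) (h, i)"
    unfolding sample_pmf_def by (intro pmf_embed_pmf) (auto simp: assms(1))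
  then show ?thesis by simp
qed

lemma weighted_empirical_eq_discrete_law:
  fixes t :: "'h::finite \<Rightarrow> real" and \<zeta> :: "'h \<Rightarrow> 'i::finite \<Rightarrow> 'a::topological_space"
  assumes t: "\<And>h. 0 \<le> t h" "(\<Sum>h\<in>UNIV. t h) = 1" and \<zeta>: "\<And>h i. \<zeta> h i \<in> S"
  shows "weighted_empirical S t \<zeta> = discrete_law S (sample_pmf t) (\<lambda>(h, i). \<zeta> h i)"
proof (rule measure_eqI)
  fix A assume "A \<in> sets (weighted_empirical S t \<zeta>)"
  then have A: "A \<in> sets (borel_on S)" by simp
  let ?z = "\<lambda>(h, i). \<zeta> h i" and ?w = "sample_pmf t :: ('h \<times> 'i) pmf"
  have "emeasure (discrete_law S ?w ?z) A = emeasure ?w (?z -` A)"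
    using A \<zeta> by (subst emeasure_distr) (auto simp: measurable_pmf_measure1 space_restrict_space)
  also have "\<dots> = (\<Sum>k\<in>?z -` A. ennreal (pmf ?w k))"
    by (subst emeasure_measure_pmf_finite) (simp_all add: sum_ennreal)
  also have "\<dots> = (\<Sum>k\<in>UNIV. ennreal (pmf ?w k) * indicator A (?z k))"
    by (intro sum.mono_neutral_cong_left) (auto split: split_indicator)
  also have "\<dots> = (\<Sum>h\<in>UNIV. \<Sum>i\<in>UNIV. ennreal (t h / real CARD('i)) * indicator A (\<zeta> h i))"
    unfolding sum.cartesian_product UNIV_Times_UNIV
    by (intro sum.cong) (auto simp: pmf_sample_pmf[OF t])
  finally show "emeasure (weighted_empirical S t \<zeta>) A = emeasure (discrete_law S ?w ?z) A"
    by (simp add: emeasure_weighted_empirical[OF A])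
qed simp

text \<open>
  A plan pairs an index of a sample, not the sample itself, with a destination in \<open>S\<close>. Keeping the
  index makes the first marginal the same \<open>w\<close> even when samples coincide.
\<close>

definition transport_plans :: "'a set \<Rightarrow> 'k pmf \<Rightarrow> ('k \<times> 'a) pmf set" where
  "transport_plans S w = {p. map_pmf fst p = w \<and> finite (set_pmf p) \<and> snd ` set_pmf p \<subseteq> S}"

text \<open>
  Plans are mixed by a biased coin, and expectations are affine in the mixture.
\<close>

lemma convex_transport_plan_values:
  fixes c f :: "'k \<times> 'a \<Rightarrow> real"
  shows "convex ((\<lambda>p. (measure_pmf.expectation p c, measure_pmf.expectation p f)) ` transport_plans S w)"
proof (rule convexI, elim imageE, goal_cases)
  case (1 _ _ u v p q)
  define r where "r = bernoulli_pmf u \<bind> (\<lambda>b. if b then p else q)"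
  have u: "0 \<le> u" "u \<le> 1" "v = 1 - u" using 1 by auto
  have fin: "finite (set_pmf p)" "finite (set_pmf q)"
    using 1 by (auto simp: transport_plans_def)
  have "map_pmf fst r = bernoulli_pmf u \<bind> (\<lambda>b. if b then map_pmf fst p else map_pmf fst q)"
    unfolding r_def map_bind_pmf by (intro bind_pmf_cong) auto
  also have "\<dots> = w"
    using 1 by (simp add: transport_plans_def bind_pmf_const cong: if_cong)
  finally have "map_pmf fst r = w" .
  moreover have sub: "set_pmf r \<subseteq> set_pmf p \<union> set_pmf q"
    unfolding r_def by (auto split: if_splits)
  ultimately have "r \<in> transport_plans S w"
    using 1 finite_subset[OF sub] fin image_mono[OF sub, of snd]
    by (simp add: transport_plans_def image_Un) (meson Un_least order_trans)
  moreover have "measure_pmf.expectation r h =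
      u * measure_pmf.expectation p h + v * measure_pmf.expectation q h" for h :: "'k \<times> 'a \<Rightarrow> real"
    unfolding r_def using fin u
    by (subst pmf_expectation_bind[where A = UNIV]) (auto simp: UNIV_bool)
  ultimately show ?case
    using 1 by (intro image_eqI[of _ _ r]) auto
qed

text \<open>
  The joint law of destination and sample is a coupling, so the transport cost of the plan bounds the
  Wasserstein distance of the law of the destination.
\<close>

lemma transport_plan_in_ambiguity_set:
  fixes f \<nu> :: "'a::euclidean_space \<Rightarrow> real" and z :: "'k \<Rightarrow> 'a"
  assumes p: "p \<in> transport_plans S w" and z: "\<And>k. z k \<in> S"
    and f: "f \<in> borel_measurable borel"
    and \<nu>: "\<nu> \<in> borel_measurable borel" "\<And>u. 0 \<le> \<nu> u"
    and cost: "measure_pmf.expectation p (\<lambda>(k, \<xi>). \<nu> (\<xi> - z k)) \<le> \<epsilon>"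
  obtains Q where "Q \<in> ambiguity_set \<nu> S \<epsilon> (discrete_law S w z)"
    and "(\<integral>\<xi>. f \<xi> \<partial>Q) = measure_pmf.expectation p (\<lambda>(k, \<xi>). f \<xi>)"
proof -
  note [measurable] = f \<nu>(1)
  \<comment> \<open>Off the support of \<open>p\<close> the second component may leave \<open>S\<close>; there it is replaced by a sample.\<close>
  define clip where "clip = (\<lambda>(k, \<xi>). if \<xi> \<in> S then \<xi> else z k)"
  have clip: "clip x \<in> S" for x
    using z by (auto simp: clip_def split: prod.split)
  have clip_eq: "clip x = snd x" if "x \<in> set_pmf p" for x
    using p that by (force simp: clip_def transport_plans_def case_prod_unfold)
  have fin: "finite (set_pmf p)" and marginal: "map_pmf fst p = w"
    using p by (auto simp: transport_plans_def)
  define Q where "Q = discrete_law S p clip"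
  define \<kappa> where "\<kappa> = distr p (borel_on S \<Otimes>\<^sub>M borel_on S) (\<lambda>x. (clip x, z (fst x)))"
  have clip_meas: "clip \<in> measure_pmf p \<rightarrow>\<^sub>M borel_on S"
    using clip by (auto simp: measurable_pmf_measure1 space_restrict_space)
  have pair_meas: "(\<lambda>x. (clip x, z (fst x))) \<in> measure_pmf p \<rightarrow>\<^sub>M borel_on S \<Otimes>\<^sub>M borel_on S"
    using clip z by (auto simp: measurable_pmf_measure1 space_restrict_space space_pair_measure)
  have diff_meas: "(\<lambda>x. ennreal (\<nu> (fst x - snd x))) \<in> borel_measurable (borel_on S \<Otimes>\<^sub>M borel_on S)"
  proof -
    have id: "(\<lambda>x. x) \<in> borel_on S \<rightarrow>\<^sub>M borel"
      by (rule measurable_restrict_space1) simp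
    have [measurable]: "fst \<in> borel_on S \<Otimes>\<^sub>M borel_on S \<rightarrow>\<^sub>M borel" "snd \<in> borel_on S \<Otimes>\<^sub>M borel_on S \<rightarrow>\<^sub>M borel"
      by (rule measurable_compose[OF measurable_fst id] measurable_compose[OF measurable_snd id])+
    show ?thesis by measurable
  qed
  have Q: "Q \<in> finite_moment_distributions \<nu> S"
  proof -
    have "(\<integral>\<^sup>+ \<xi>. ennreal (\<nu> \<xi>) \<partial>Q) = (\<integral>\<^sup>+ x. ennreal (\<nu> (clip x)) \<partial>p)"
      unfolding Q_def by (intro nn_integral_distr clip_meas) (simp add: measurable_restrict_space1)
    also have "\<dots> < \<infinity>"
      using fin \<nu>(2) by (simp add: nn_integral_measure_pmf_finite ennreal_mult_less_top)
    finally show ?thesis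
      using measure_pmf.prob_space_distr[OF clip_meas]
      by (simp add: finite_moment_distributions_def space_prob_algebra Q_def)
  qed
  have "distr \<kappa> (borel_on S) fst = Q"
    unfolding \<kappa>_def Q_def by (simp add: distr_distr[OF measurable_fst pair_meas] o_def)
  moreover have "distr \<kappa> (borel_on S) snd = discrete_law S w z"
    unfolding \<kappa>_def marginal[symmetric] using z
    by (simp add: distr_distr[OF measurable_snd pair_meas] map_pmf_rep_eq)
       (subst distr_distr, auto simp: o_def measurable_pmf_measure1 space_restrict_space)
  ultimately have "\<kappa> \<in> couplings S Q (discrete_law S w z)"
    using measure_pmf.prob_space_distr[OF pair_meas]
    by (simp add: couplings_def space_prob_algebra \<kappa>_def)
  then have "wasserstein \<nu> S (discrete_law S w z) Q \<le> (\<integral>\<^sup>+ (\<xi>, \<xi>'). ennreal (\<nu> (\<xi> - \<xi>')) \<partial>\<kappa>)"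
    unfolding wasserstein_def by (rule INF_lower)
  also have "\<dots> = (\<integral>\<^sup>+ x. ennreal (\<nu> (clip x - z (fst x))) \<partial>p)"
    unfolding \<kappa>_def case_prod_unfold by (subst nn_integral_distr[OF pair_meas]) (simp_all add: diff_meas)
  also have "\<dots> = (\<integral>\<^sup>+ (k, \<xi>). ennreal (\<nu> (\<xi> - z k)) \<partial>p)"
    using clip_eq by (intro nn_integral_cong_AE) (simp add: AE_measure_pmf_iff case_prod_unfold)
  also have "\<dots> = ennreal (measure_pmf.expectation p (\<lambda>(k, \<xi>). \<nu> (\<xi> - z k)))"
    unfolding case_prod_unfold using \<nu>(2)
    by (intro nn_integral_eq_integral integrable_measure_pmf_finite fin) simp
  also have "\<dots> \<le> ennreal \<epsilon>"
    using cost by (rule ennreal_leI)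
  finally have "Q \<in> ambiguity_set \<nu> S \<epsilon> (discrete_law S w z)"
    using Q by (simp add: ambiguity_set_def)
  moreover have "(\<integral>\<xi>. f \<xi> \<partial>Q) = measure_pmf.expectation p (\<lambda>x. f (clip x))"
    unfolding Q_def by (intro integral_distr clip_meas measurable_restrict_space1 f)
  moreover have "measure_pmf.expectation p (\<lambda>x. f (clip x)) = measure_pmf.expectation p (\<lambda>(k, \<xi>). f \<xi>)"
    using clip_eq by (intro integral_cong_AE) (simp_all add: AE_measure_pmf_iff case_prod_unfold)
  ultimately show ?thesis
    using that by simp
qed

text \<open>
  Weak duality. The pointwise bound depends on the index \<open>k\<close>, while a coupling only sees the sample
  \<open>z k\<close>; the proof passes to a function \<open>\<Phi>\<close> of the sample. The Wasserstein distance is an infimum, so the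
  coupling integrated against may exceed the budget by \<open>e'\<close>, chosen with \<open>\<mu> * e' \<le> e\<close>.
\<close>

lemma expectation_ambiguity_set_le:
  fixes f \<nu> :: "'a::euclidean_space \<Rightarrow> real" and z :: "'k::finite \<Rightarrow> 'a"
  assumes S: "compact S" and z: "\<And>k. z k \<in> S"
    and f: "continuous_on UNIV f" and \<nu>: "continuous_on UNIV \<nu>" "\<And>u. 0 \<le> \<nu> u"
    and \<mu>: "0 \<le> \<mu>" and \<epsilon>: "0 \<le> \<epsilon>"
    and bound: "\<And>k \<xi>. \<xi> \<in> S \<Longrightarrow> f \<xi> \<le> s k + \<mu> * \<nu> (\<xi> - z k)"
    and Q: "Q \<in> ambiguity_set \<nu> S \<epsilon> (discrete_law S w z)"
  shows "(\<integral>\<xi>. f \<xi> \<partial>Q) \<le> \<mu> * \<epsilon> + (\<Sum>k\<in>UNIV. pmf w k * s k)"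
proof -
  have meas: "f \<in> borel_measurable borel" "\<nu> \<in> borel_measurable borel"
    using f \<nu>(1) by (auto intro: borel_measurable_continuous_onI)
  obtain M where M: "\<And>\<xi>. \<xi> \<in> S \<Longrightarrow> \<bar>f \<xi>\<bar> \<le> M"
    using compact_imp_bounded[OF compact_continuous_image[OF continuous_on_subset[OF f subset_UNIV] S]]
    by (auto simp: bounded_iff)
  \<comment> \<open>Samples may coincide, so at an atom the smallest of their values \<open>s k\<close> is used; off the
      atoms the trivial bound \<open>M\<close> is good enough.\<close>
  define \<Phi> where "\<Phi> y = (if y \<in> range z then Min (s ` {k. z k = y}) else M)" for y
  have \<Phi>_le: "\<Phi> (z k) \<le> s k" for k
    by (auto simp: \<Phi>_def)
  have dual_bound: "f \<xi> \<le> \<Phi> \<xi>' + \<mu> * \<nu> (\<xi> - \<xi>')" if "\<xi> \<in> S" for \<xi> \<xi>'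
  proof (cases "\<xi>' \<in> range z")
    case True
    then have "Min (s ` {k. z k = \<xi>'}) \<in> s ` {k. z k = \<xi>'}"
      by (intro Min_in) auto
    then obtain k where "z k = \<xi>'" "\<Phi> \<xi>' = s k"
      using True by (auto simp: \<Phi>_def)
    then show ?thesis using bound[OF that, of k] by simp
  next
    case False
    have "0 \<le> \<mu> * \<nu> (\<xi> - \<xi>')" using \<mu> \<nu>(2) by simp
    then show ?thesis using False M[OF that] by (simp add: \<Phi>_def)
  qed
  have \<Phi>_meas: "\<Phi> \<in> borel_measurable borel"
  proof -
    have "\<Phi> = (\<lambda>y. M + (\<Sum>x\<in>range z. (Min (s ` {k. z k = x}) - M) * indicator {x} y))"
    proof
      fix y
      have "(\<Sum>x\<in>range z. (Min (s ` {k. z k = x}) - M) * indicator {x} y) =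
          (\<Sum>x\<in>range z. if x = y then Min (s ` {k. z k = x}) - M else 0)"
        by (intro sum.cong) (auto split: split_indicator)
      then show "\<Phi> y = M + (\<Sum>x\<in>range z. (Min (s ` {k. z k = x}) - M) * indicator {x} y)"
        by (simp add: \<Phi>_def)
    qed
    moreover have "(\<lambda>y. M + (\<Sum>x\<in>range z. (Min (s ` {k. z k = x}) - M) * indicator {x} y))
        \<in> borel_measurable borel"
      by measurable
    ultimately show ?thesis by metis
  qed
  obtain D where D: "\<And>y. \<bar>\<Phi> y\<bar> \<le> D"
  proof -
    have "finite (range \<Phi>)"
      by (rule finite_subset[of _ "insert M ((\<lambda>y. Min (s ` {k. z k = y})) ` range z)"])
         (auto simp: \<Phi>_def)
    then have "bounded (range \<Phi>)" by (rule finite_imp_bounded)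
    then show ?thesis using that by (auto simp: bounded_iff)
  qed
  show ?thesis
  proof (rule field_le_epsilon)
    fix e :: real assume e: "0 < e"
    define e' where "e' = e / (\<mu> + 1)"
    have e': "0 < e'" "\<mu> * e' \<le> e"
      using e \<mu> by (simp_all add: e'_def field_simps)
    have "wasserstein \<nu> S (discrete_law S w z) Q \<le> ennreal \<epsilon>"
      using Q by (simp add: ambiguity_set_def)
    also have "\<dots> < ennreal (\<epsilon> + e')"
      using \<epsilon> e'(1) by (simp add: ennreal_less_iff)
    finally obtain \<kappa> where \<kappa>: "\<kappa> \<in> couplings S Q (discrete_law S w z)"
      and cost: "(\<integral>\<^sup>+ (\<xi>, \<xi>'). ennreal (\<nu> (\<xi> - \<xi>')) \<partial>\<kappa>) < ennreal (\<epsilon> + e')"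
      unfolding wasserstein_def INF_less_iff by blast
    have sets_\<kappa>: "sets \<kappa> = sets (borel_on S \<Otimes>\<^sub>M borel_on S)" and "prob_space \<kappa>"
      and marg: "distr \<kappa> (borel_on S) fst = Q" "distr \<kappa> (borel_on S) snd = discrete_law S w z"
      using \<kappa> by (auto simp: couplings_def space_prob_algebra)
    interpret \<kappa>: prob_space \<kappa> by fact
    have space_\<kappa>: "space \<kappa> = S \<times> S"
      using sets_eq_imp_space_eq[OF sets_\<kappa>] by (simp add: space_pair_measure space_restrict_space)
    have fst_meas: "fst \<in> \<kappa> \<rightarrow>\<^sub>M borel_on S" and snd_meas: "snd \<in> \<kappa> \<rightarrow>\<^sub>M borel_on S"
      unfolding measurable_cong_sets[OF sets_\<kappa> refl] by simp_all
    have [measurable]: "fst \<in> borel_measurable \<kappa>" "snd \<in> borel_measurable \<kappa>"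
      using measurable_restrict_space2_iff[of fst \<kappa> borel S] measurable_restrict_space2_iff[of snd \<kappa> borel S]
        fst_meas snd_meas by auto
    note [measurable] = meas \<Phi>_meas
    have int_f: "integrable \<kappa> (\<lambda>x. f (fst x))"
      by (rule \<kappa>.integrable_const_bound[of _ M]) (auto intro!: AE_I2 M simp: space_\<kappa>)
    have int_\<Phi>: "integrable \<kappa> (\<lambda>x. \<Phi> (snd x))"
      by (rule \<kappa>.integrable_const_bound[of _ D]) (auto intro!: AE_I2 D)
    have int_\<nu>: "integrable \<kappa> (\<lambda>x. \<nu> (fst x - snd x))"
      using cost \<nu>(2) by (intro integrableI_bounded) (auto simp: case_prod_unfold intro: order.strict_trans[OF _ ennreal_less_top])
    have cost': "(\<integral>x. \<nu> (fst x - snd x) \<partial>\<kappa>) \<le> \<epsilon> + e'"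
    proof -
      have "ennreal (\<integral>x. \<nu> (fst x - snd x) \<partial>\<kappa>) = (\<integral>\<^sup>+ (\<xi>, \<xi>'). ennreal (\<nu> (\<xi> - \<xi>')) \<partial>\<kappa>)"
        unfolding case_prod_unfold using \<nu>(2) by (intro nn_integral_eq_integral[symmetric] int_\<nu>) simp
      then show ?thesis
        using cost \<epsilon> e'(1) by (metis add_nonneg_nonneg ennreal_le_iff less_imp_le)
    qed
    have "(\<integral>\<xi>. f \<xi> \<partial>Q) = (\<integral>x. f (fst x) \<partial>\<kappa>)"
      unfolding marg(1)[symmetric]
      by (intro integral_distr fst_meas measurable_restrict_space1 meas)
    also have "\<dots> \<le> (\<integral>x. \<Phi> (snd x) + \<mu> * \<nu> (fst x - snd x) \<partial>\<kappa>)"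
      using int_f int_\<Phi> int_\<nu>
      by (intro integral_mono Bochner_Integration.integrable_add integrable_mult_right)
         (auto intro!: dual_bound simp: space_\<kappa>)
    also have "\<dots> = (\<integral>x. \<Phi> (snd x) \<partial>\<kappa>) + \<mu> * (\<integral>x. \<nu> (fst x - snd x) \<partial>\<kappa>)"
      using int_\<Phi> int_\<nu> by simp
    also have "(\<integral>x. \<Phi> (snd x) \<partial>\<kappa>) = (\<integral>y. \<Phi> y \<partial>discrete_law S w z)"
      unfolding marg(2)[symmetric]
      by (intro integral_distr[symmetric] snd_meas measurable_restrict_space1 \<Phi>_meas)
    also have "\<dots> = (\<integral>k. \<Phi> (z k) \<partial>measure_pmf w)"
      using z by (intro integral_distr measurable_restrict_space1 \<Phi>_meas)
        (auto simp: measurable_pmf_measure1 space_restrict_space)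
    also have "\<dots> = (\<Sum>k\<in>UNIV. pmf w k * \<Phi> (z k))"
      by (subst integral_measure_pmf[of UNIV]) auto
    also have "\<dots> \<le> (\<Sum>k\<in>UNIV. pmf w k * s k)"
      by (intro sum_mono mult_left_mono \<Phi>_le) simp
    also have "\<mu> * (\<integral>x. \<nu> (fst x - snd x) \<partial>\<kappa>) \<le> \<mu> * \<epsilon> + e"
      using mult_left_mono[OF cost' \<mu>] e'(2) by (simp add: distrib_left)
    finally show "(\<integral>\<xi>. f \<xi> \<partial>Q) \<le> \<mu> * \<epsilon> + (\<Sum>k\<in>UNIV. pmf w k * s k) + e"
      by simp
  qed
qed

text \<open>
  Strong duality for the budget \<open>\<epsilon>\<close>. For \<open>\<epsilon> > 0\<close> the plan that leaves every sample in place is a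
  Slater point for the multiplier lemma. For \<open>\<epsilon> = 0\<close> there is none, but the Lipschitz constant of \<open>f\<close>
  is a valid price: no unit of transport gains more than \<open>K\<close>.
\<close>

lemma exists_penalty:
  fixes f \<nu> :: "'a::euclidean_space \<Rightarrow> real" and z :: "'k::finite \<Rightarrow> 'a"
  defines "cost \<equiv> \<lambda>p. measure_pmf.expectation p (\<lambda>(k, \<xi>). \<nu> (\<xi> - z k))"
    and "reward \<equiv> \<lambda>p :: ('k \<times> 'a) pmf. measure_pmf.expectation p (\<lambda>(k, \<xi>). f \<xi>)"
  assumes z: "\<And>k. z k \<in> S" and zero: "\<nu> 0 = 0" and \<epsilon>: "0 \<le> \<epsilon>"
    and K: "0 \<le> K" and lipschitz: "\<And>\<xi> \<xi>'. f \<xi> \<le> f \<xi>' + K * \<nu> (\<xi> - \<xi>')"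
    and bound: "\<And>p. p \<in> transport_plans S w \<Longrightarrow> cost p \<le> \<epsilon> \<Longrightarrow> reward p \<le> y"
  obtains \<mu> where "0 \<le> \<mu>" "\<And>p. p \<in> transport_plans S w \<Longrightarrow> reward p + \<mu> * (\<epsilon> - cost p) \<le> y"
proof -
  define stay where "stay = map_pmf (\<lambda>k. (k, z k)) w"
  have stay: "stay \<in> transport_plans S w" "cost stay = 0"
      "reward stay = measure_pmf.expectation w (\<lambda>k. f (z k))"
    using z zero by (auto simp: stay_def transport_plans_def cost_def reward_def pmf.map_comp o_def)
  show ?thesis
  proof (cases "\<epsilon> = 0")
    case False
    then have pos: "0 < \<epsilon>" using \<epsilon> by simp
    define A where "A = (\<lambda>p. (cost p, reward p)) ` transport_plans S w"
    have A: "convex A"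
      unfolding A_def cost_def reward_def by (rule convex_transport_plan_values)
    have slater: "(0, reward stay) \<in> A"
      unfolding A_def using stay by force
    have "v \<le> y" if "(c, v) \<in> A" "c \<le> \<epsilon>" for c v
      using that bound by (auto simp: A_def)
    then obtain \<mu> where "0 \<le> \<mu>" "\<And>c v. (c, v) \<in> A \<Longrightarrow> v + \<mu> * (\<epsilon> - c) \<le> y"
      using lagrange_multiplier[OF A slater pos, of y] by blast
    then show ?thesis
      by (intro that) (auto simp: A_def)
  next
    case True
    have "reward p \<le> y + K * cost p" if p: "p \<in> transport_plans S w" for p
    proof -
      have fin: "finite (set_pmf p)" and marginal: "w = map_pmf fst p"
        using p by (auto simp: transport_plans_def)
      note int = integrable_measure_pmf_finite[OF fin]
      have "reward p \<le> measure_pmf.expectation p (\<lambda>(k, \<xi>). f (z k) + K * \<nu> (\<xi> - z k))"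
        unfolding reward_def by (intro integral_mono int) (auto intro: lipschitz)
      also have "\<dots> = measure_pmf.expectation p (\<lambda>x. f (z (fst x))) + K * cost p"
        unfolding cost_def case_prod_unfold by (simp add: int)
      also have "measure_pmf.expectation p (\<lambda>x. f (z (fst x))) = reward stay"
        by (simp add: stay(3) marginal)
      also have "reward stay \<le> y"
        using stay True by (intro bound) auto
      finally show ?thesis by simp
    qed
    then show ?thesis
      using True by (intro that[OF K]) force
  qed
qed

lemma compact_block_product:
  fixes S :: "'n::finite \<Rightarrow> (real^'m) set"
  assumes "\<And>n. compact (S n)"
  shows "compact (block_product S)"
proof -
  have "closed (block_product S)"
  proof -
    have "block_product S = (\<Inter>n. (\<lambda>\<xi>. \<xi> $ n) -` S n)"
      by (auto simp: block_product_def)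
    moreover have "closed ((\<lambda>\<xi> :: real^'m^'n. \<xi> $ n) -` S n)" for n
      using assms by (intro closed_vimage compact_imp_closed continuous_intros)
    ultimately show ?thesis by (simp add: closed_INT)
  qed
  moreover have "bounded (block_product S)"
  proof -
    have "\<exists>B. \<forall>u\<in>S n. norm u \<le> B" for n
      using compact_imp_bounded[OF assms[of n]] by (simp add: bounded_iff)
    then obtain B where B: "\<And>n u. u \<in> S n \<Longrightarrow> norm u \<le> B n" by metis
    have "norm \<xi> \<le> (\<Sum>n\<in>UNIV. B n)" if "\<xi> \<in> block_product S" for \<xi>
    proof -
      have "norm \<xi> \<le> (\<Sum>n\<in>UNIV. norm (\<xi> $ n))"
        unfolding norm_vec_def by (intro L2_set_le_sum) simp
      also have "\<dots> \<le> (\<Sum>n\<in>UNIV. B n)"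
        using that by (intro sum_mono B) (simp add: block_product_def)
      finally show ?thesis .
    qed
    then show ?thesis by (auto simp: bounded_iff)
  qed
  ultimately show ?thesis by (simp add: compact_eq_bounded_closed)
qed

section \<open>The reformulation\<close>

theorem theorem3:
  fixes X :: "(real^'k) set"
    and \<nu> :: "real^'m \<Rightarrow> real"
    and L :: "'n::finite \<Rightarrow> nat"
    and C :: "'n \<Rightarrow> nat \<Rightarrow> real^'m"
    and g :: "'n \<Rightarrow> nat \<Rightarrow> real"
    and a :: "'n \<Rightarrow> 'j::finite \<Rightarrow> real^'k \<Rightarrow> real^'m"
    and b :: "'n \<Rightarrow> 'j \<Rightarrow> real^'k \<Rightarrow> real"
    and \<zeta> :: "'h::finite \<Rightarrow> 'i::finite \<Rightarrow> real^'m^'n"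
    and t :: "'h \<Rightarrow> real"
    and \<epsilon> :: real
  defines "\<Xi> \<equiv> block_product (\<lambda>n. polyhedral_set (L n) (C n) (g n))"
  defines "B \<equiv> ambiguity_set (norm_sum \<nu>) \<Xi> \<epsilon> (weighted_empirical \<Xi> t \<zeta>)"
  assumes X: "closed X"
    and norm: "is_norm \<nu>"
    and polytope: "\<And>n. polytope (polyhedral_set (L n) (C n) (g n))"
    and nonempty: "\<And>n. polyhedral_set (L n) (C n) (g n) \<noteq> {}"
    and a: "\<And>n j. linear (a n j)"
    and b: "\<And>n j. linear (b n j)"
    and \<zeta>: "\<And>h i. \<zeta> h i \<in> \<Xi>"
    and t: "\<And>h. t h \<in> {0..1}" "(\<Sum>h\<in>UNIV. t h) = 1"
    and \<epsilon>: "\<epsilon> \<ge> 0"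
  shows "(\<forall>x\<in>X. worst_case B (loss a b x) =
           (INF (lam, s, \<gamma>)\<in>{(lam, s, \<gamma>). reform_feasible \<nu> L C g a b \<zeta> x lam s \<gamma>}.
              ereal (reform_objective \<epsilon> t lam s))) \<and>
         (INF x\<in>X. worst_case B (loss a b x)) =
           (INF (x, lam, s, \<gamma>)\<in>{(x, lam, s, \<gamma>). x \<in> X \<and> reform_feasible \<nu> L C g a b \<zeta> x lam s \<gamma>}.
              ereal (reform_objective \<epsilon> t lam s))"
proof -
  define w where "w = (sample_pmf t :: ('h \<times> 'i) pmf)"
  define z where "z = (\<lambda>(h, i). \<zeta> h i)"
  have t_nonneg: "0 \<le> t h" for h using t(1)[of h] by simp
  have block: "\<xi> $ n \<in> polyhedral_set (L n) (C n) (g n)" if "\<xi> \<in> \<Xi>" for \<xi> n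
    using that by (simp add: \<Xi>_def block_product_def)
  have compact_P: "compact (polyhedral_set (L n) (C n) (g n))" for n
    by (rule polytope_imp_compact[OF polytope])
  have compact_\<Xi>: "compact \<Xi>"
    unfolding \<Xi>_def by (rule compact_block_product[OF compact_P])
  have z: "z k \<in> \<Xi>" for k
    using \<zeta> by (simp add: z_def case_prod_unfold)
  have B: "B = ambiguity_set (norm_sum \<nu>) \<Xi> \<epsilon> (discrete_law \<Xi> w z)"
    unfolding B_def w_def z_def by (simp add: weighted_empirical_eq_discrete_law[OF t_nonneg t(2) \<zeta>])
  have N: "is_norm (norm_sum \<nu> :: real^'m^'n \<Rightarrow> real)"
    by (rule is_norm_norm_sum[OF norm])
  have objective: "reform_objective \<epsilon> t lam s =
      lam * \<epsilon> + (\<Sum>k\<in>UNIV. pmf w k * (\<Sum>n\<in>UNIV. s (fst k) (snd k) n))"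
    for lam and s :: "'h \<Rightarrow> 'i \<Rightarrow> 'n \<Rightarrow> real"
  proof -
    have "(\<Sum>h\<in>UNIV. \<Sum>i\<in>UNIV. \<Sum>n\<in>UNIV. t h / real CARD('i) * s h i n) =
        (\<Sum>h\<in>UNIV. \<Sum>i\<in>UNIV. pmf w (h, i) * (\<Sum>n\<in>UNIV. s h i n))"
      by (simp add: w_def pmf_sample_pmf[OF t_nonneg t(2)] sum_distrib_left)
    then show ?thesis
      unfolding reform_objective_def by (simp add: sum.cartesian_product case_prod_unfold)
  qed
  have pointwise: "worst_case B (loss a b x) =
      (INF (lam, s, \<gamma>)\<in>{(lam, s, \<gamma>). reform_feasible \<nu> L C g a b \<zeta> x lam s \<gamma>}.
         ereal (reform_objective \<epsilon> t lam s))" for x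
  proof (rule antisym)
    have loss_cont: "continuous_on UNIV (loss a b x)"
      unfolding loss_eq_sum_block_loss[abs_def]
      by (intro continuous_on_sum continuous_on_compose2[OF continuous_on_block_loss[where S = UNIV]]
          continuous_intros) auto
    note feasible_iff = reform_feasible_iff[where a = a and b = b and x = x and \<zeta> = \<zeta>, OF norm block[OF \<zeta>]]
    show "worst_case B (loss a b x) \<le>
      (INF (lam, s, \<gamma>)\<in>{(lam, s, \<gamma>). reform_feasible \<nu> L C g a b \<zeta> x lam s \<gamma>}.
         ereal (reform_objective \<epsilon> t lam s))"
    proof (intro INF_greatest, clarify)
      fix lam s \<gamma> assume "reform_feasible \<nu> L C g a b \<zeta> x lam s \<gamma>"
      then have lam: "0 \<le> lam" and le: "\<And>h i n u. u \<in> polyhedral_set (L n) (C n) (g n) \<Longrightarrow>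
          block_loss a b x n u \<le> s h i n + lam * \<nu> (u - \<zeta> h i $ n)"
        using feasible_iff[where lam = lam and s = s] by blast+
      have "loss a b x \<xi> \<le> (\<Sum>n\<in>UNIV. s (fst k) (snd k) n) + lam * norm_sum \<nu> (\<xi> - z k)"
        if "\<xi> \<in> \<Xi>" for k \<xi>
        unfolding loss_eq_sum_block_loss norm_sum_def sum_distrib_left sum.distrib[symmetric]
          z_def case_prod_unfold
        using le[OF block[OF that]] by (intro sum_mono) simp
      then have "(\<integral>\<xi>. loss a b x \<xi> \<partial>Q) \<le> reform_objective \<epsilon> t lam s" if "Q \<in> B" for Q
        unfolding objective using that
        by (intro expectation_ambiguity_set_le[OF compact_\<Xi> z loss_cont is_norm_continuous[OF N]
              is_norm_nonneg[OF N] lam \<epsilon>]) (auto simp: B)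
      then show "worst_case B (loss a b x) \<le> ereal (reform_objective \<epsilon> t lam s)"
        unfolding worst_case_def by (intro SUP_least) simp
    qed
    show "(INF (lam, s, \<gamma>)\<in>{(lam, s, \<gamma>). reform_feasible \<nu> L C g a b \<zeta> x lam s \<gamma>}.
         ereal (reform_objective \<epsilon> t lam s)) \<le> worst_case B (loss a b x)"
    \<comment> \<open>Testing against real upper bounds \<open>y\<close> spares a proof that the supremum is finite.\<close>
    proof (rule ereal_le_real)
      fix y assume y: "worst_case B (loss a b x) \<le> ereal y"
      obtain K where K: "0 \<le> K"
        "\<And>\<xi> \<xi>'. loss a b x \<xi> \<le> loss a b x \<xi>' + K * norm_sum \<nu> (\<xi> - \<xi>')"
        using loss_lipschitz[OF norm] by blast
      have plan_le: "measure_pmf.expectation p (\<lambda>(k, \<xi>). loss a b x \<xi>) \<le> y"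
        if p: "p \<in> transport_plans \<Xi> w"
          and cost: "measure_pmf.expectation p (\<lambda>(k, \<xi>). norm_sum \<nu> (\<xi> - z k)) \<le> \<epsilon>" for p
      proof -
        obtain Q where Q: "Q \<in> B"
          "(\<integral>\<xi>. loss a b x \<xi> \<partial>Q) = measure_pmf.expectation p (\<lambda>(k, \<xi>). loss a b x \<xi>)"
          using transport_plan_in_ambiguity_set[OF p z borel_measurable_continuous_onI[OF loss_cont]
              borel_measurable_continuous_onI[OF is_norm_continuous[OF N]] is_norm_nonneg[OF N] cost]
          unfolding B by blast
        have "ereal (\<integral>\<xi>. loss a b x \<xi> \<partial>Q) \<le> ereal y"
          using Q(1) y unfolding worst_case_def by (meson SUP_upper order_trans)
        then show ?thesis by (simp add: Q(2))
      qed
      obtain \<mu> where \<mu>: "0 \<le> \<mu>" "\<And>p. p \<in> transport_plans \<Xi> w \<Longrightarrow>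
          measure_pmf.expectation p (\<lambda>(k, \<xi>). loss a b x \<xi>) +
          \<mu> * (\<epsilon> - measure_pmf.expectation p (\<lambda>(k, \<xi>). norm_sum \<nu> (\<xi> - z k))) \<le> y"
        using exists_penalty[where f = "loss a b x" and \<nu> = "norm_sum \<nu>" and z = z and S = \<Xi>
            and w = w and y = y, OF z is_norm_zero[OF N] \<epsilon> K plan_le]
        by blast
      \<comment> \<open>At the price \<open>\<mu>\<close> the penalised loss separates, so each block of each sample is moved to
          an optimal destination of its own.\<close>
      define pen where "pen k n u = block_loss a b x n u - \<mu> * \<nu> (u - z k $ n)" for k n u
      define opt where "opt k n u \<longleftrightarrow> u \<in> polyhedral_set (L n) (C n) (g n) \<and>
          (\<forall>u'\<in>polyhedral_set (L n) (C n) (g n). pen k n u' \<le> pen k n u)" for k n u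
      define best where "best k n = (SOME u. opt k n u)" for k n
      have "\<exists>u. opt k n u" for k n
        unfolding opt_def pen_def Bex_def[symmetric]
        by (intro continuous_attains_sup compact_P nonempty continuous_intros continuous_on_block_loss
            continuous_on_compose2[OF is_norm_continuous[OF norm]]) auto
      then have "opt k n (best k n)" for k n
        unfolding best_def by (rule someI_ex)
      then have best: "best k n \<in> polyhedral_set (L n) (C n) (g n)"
        "u \<in> polyhedral_set (L n) (C n) (g n) \<Longrightarrow> pen k n u \<le> pen k n (best k n)" for k n u
        by (simp_all add: opt_def)
      define s where "s = (\<lambda>h i n. pen (h, i) n (best (h, i) n))"
      have "\<exists>\<gamma>. reform_feasible \<nu> L C g a b \<zeta> x \<mu> s \<gamma>"
        unfolding feasible_iff
      proof (intro conjI allI ballI)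
        fix h i n u assume "u \<in> polyhedral_set (L n) (C n) (g n)"
        then have "pen (h, i) n u \<le> pen (h, i) n (best (h, i) n)"
          by (rule best(2))
        then show "block_loss a b x n u \<le> s h i n + \<mu> * \<nu> (u - \<zeta> h i $ n)"
          by (simp add: s_def pen_def z_def)
      qed (rule \<mu>(1))
      then obtain \<gamma> where \<gamma>: "reform_feasible \<nu> L C g a b \<zeta> x \<mu> s \<gamma>" ..
      define p where "p = map_pmf (\<lambda>k. (k, \<chi> n. best k n)) w"
      have "p \<in> transport_plans \<Xi> w"
        using best(1) by (auto simp: p_def transport_plans_def pmf.map_comp o_def \<Xi>_def block_product_def)
      then have "measure_pmf.expectation p (\<lambda>(k, \<xi>). loss a b x \<xi>) +
          \<mu> * (\<epsilon> - measure_pmf.expectation p (\<lambda>(k, \<xi>). norm_sum \<nu> (\<xi> - z k))) \<le> y"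
        by (rule \<mu>(2))
      \<comment> \<open>The optimal values \<open>s\<close> add up to the penalised loss of \<open>p\<close>.\<close>
      moreover have "reform_objective \<epsilon> t \<mu> s = measure_pmf.expectation p (\<lambda>(k, \<xi>). loss a b x \<xi>) +
          \<mu> * (\<epsilon> - measure_pmf.expectation p (\<lambda>(k, \<xi>). norm_sum \<nu> (\<xi> - z k)))"
      proof -
        have E: "measure_pmf.expectation w f = (\<Sum>k\<in>UNIV. pmf w k * f k)" for f :: "_ \<Rightarrow> real"
          by (subst integral_measure_pmf[of UNIV]) auto
        show ?thesis
          unfolding objective p_def
          by (simp add: E s_def pen_def loss_eq_sum_block_loss norm_sum_def algebra_simps sum_subtractf
              sum_distrib_left)
      qed
      ultimately have "ereal (reform_objective \<epsilon> t \<mu> s) \<le> ereal y" by simp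
      moreover have "(INF (lam, s, \<gamma>)\<in>{(lam, s, \<gamma>). reform_feasible \<nu> L C g a b \<zeta> x lam s \<gamma>}.
         ereal (reform_objective \<epsilon> t lam s)) \<le> ereal (reform_objective \<epsilon> t \<mu> s)"
        using \<gamma> by (intro INF_lower2[of "(\<mu>, s, \<gamma>)"]) auto
      ultimately show "(INF (lam, s, \<gamma>)\<in>{(lam, s, \<gamma>). reform_feasible \<nu> L C g a b \<zeta> x lam s \<gamma>}.
         ereal (reform_objective \<epsilon> t lam s)) \<le> ereal y"
        by (rule order_trans[rotated])
    qed
  qed
  have "(INF x\<in>X. worst_case B (loss a b x)) =
      (INF (x, lam, s, \<gamma>)\<in>{(x, lam, s, \<gamma>). x \<in> X \<and> reform_feasible \<nu> L C g a b \<zeta> x lam s \<gamma>}.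
         ereal (reform_objective \<epsilon> t lam s))"
    unfolding pointwise
  proof (rule antisym)
    show "(INF x\<in>X. INF (lam, s, \<gamma>)\<in>{(lam, s, \<gamma>). reform_feasible \<nu> L C g a b \<zeta> x lam s \<gamma>}.
         ereal (reform_objective \<epsilon> t lam s)) \<le>
      (INF (x, lam, s, \<gamma>)\<in>{(x, lam, s, \<gamma>). x \<in> X \<and> reform_feasible \<nu> L C g a b \<zeta> x lam s \<gamma>}.
         ereal (reform_objective \<epsilon> t lam s))"
    proof (intro INF_greatest, clarify)
      fix x lam s \<gamma> assume "x \<in> X" "reform_feasible \<nu> L C g a b \<zeta> x lam s \<gamma>"
      then show "(INF x\<in>X. INF (lam, s, \<gamma>)\<in>{(lam, s, \<gamma>). reform_feasible \<nu> L C g a b \<zeta> x lam s \<gamma>}.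
         ereal (reform_objective \<epsilon> t lam s)) \<le> ereal (reform_objective \<epsilon> t lam s)"
        by (intro INF_lower2[of x] INF_lower2[of "(lam, s, \<gamma>)"]) auto
    qed
    show "(INF (x, lam, s, \<gamma>)\<in>{(x, lam, s, \<gamma>). x \<in> X \<and> reform_feasible \<nu> L C g a b \<zeta> x lam s \<gamma>}.
         ereal (reform_objective \<epsilon> t lam s)) \<le>
      (INF x\<in>X. INF (lam, s, \<gamma>)\<in>{(lam, s, \<gamma>). reform_feasible \<nu> L C g a b \<zeta> x lam s \<gamma>}.
         ereal (reform_objective \<epsilon> t lam s))"
    proof (intro INF_greatest, clarify)
      fix x lam s \<gamma> assume "x \<in> X" "reform_feasible \<nu> L C g a b \<zeta> x lam s \<gamma>"
      then show "(INF (x, lam, s, \<gamma>)\<in>{(x, lam, s, \<gamma>). x \<in> X \<and> reform_feasible \<nu> L C g a b \<zeta> x lam s \<gamma>}.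
         ereal (reform_objective \<epsilon> t lam s)) \<le> ereal (reform_objective \<epsilon> t lam s)"
        by (intro INF_lower2[of "(x, lam, s, \<gamma>)"]) auto
    qed
  qed
  with pointwise show ?thesis by blast
qed

end
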